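(* Let $G$ be a countably infinite graph. The following are equivalent: (i) $G$ is ME-homogeneous; (ii) $G$ is HE-homogeneous; (iii) $G$ is MB-homogeneous or $G\cong I_\omega[K_n]$ for some integer $n\geq 2$. In class notation: $\mathrm{ME}=\mathrm{HE}=\mathrm{MB}\cup\{I_\omega[K_n]:n\geq 2\}$.
   Context: All graphs are undirected and loopless; $\sim$ denotes adjacency, and all subgraphs are induced. A homomorphism of graphs maps adjacent vertices to adjacent vertices; a monomorphism is an injective homomorphism; an isomorphism (embedding) is an injective map preserving both adjacency and non-adjacency. For $\mathrm{X}\in\{\mathrm{H},\mathrm{M},\mathrm{I}\}$, an X-morphism is a homomorphism, monomorphism, or isomorphism onto its image, respectively. For $\mathrm{Y}\in\{\mathrm{H},\mathrm{I},\mathrm{A},\mathrm{E},\mathrm{B},\mathrm{M}\}$, a Y-morphism $G\to G$ is, respectively, an endomorphism, a self-embedding, an automorphism, a surjective endomorphism (epimorphism), a bijective endomorphism (bimorphism), or an injective endomorphism. A countable graph $G$ is XY-homogeneous if every X-morphism between finite induced subgraphs of $G$ is the restriction of a Y-morphism $G\to G$. XY also denotes the class of countably infinite XY-homogeneous graphs up to isomorphism. $K_\kappa$ is the complete graph and $I_\kappa$ the edgeless graph on $\kappa$ vertices. For graphs $G,H$, the lexicographic product $G[H]$ has vertex set $G\times H$ with $(g,h)\sim(g',h')$ iff $g\sim g'$ in $G$, or $g=g'$ and $h\sim h'$ in $H$; thus $I_\omega[K_n]$ is the disjoint union of countably many copies of $K_n$. *)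

theory Defs
  imports Main "HOL-Library.Countable_Set"
begin

type_synonym 'a graph = "'a set \<times> ('a \<Rightarrow> 'a \<Rightarrow> bool)"

definition verts :: "'a graph \<Rightarrow> 'a set" where "verts G = fst G"
definition adj :: "'a graph \<Rightarrow> 'a \<Rightarrow> 'a \<Rightarrow> bool" where "adj G = snd G"

definition is_graph :: "'a graph \<Rightarrow> bool" where
  "is_graph G \<longleftrightarrow> (\<forall>x y. adj G x y \<longrightarrow> x \<in> verts G \<and> y \<in> verts G)
      \<and> (\<forall>x y. adj G x y \<longrightarrow> adj G y x) \<and> (\<forall>x. \<not> adj G x x)"

definition edgeless :: "'a set \<Rightarrow> 'a graph" where
  "edgeless S = (S, \<lambda>_ _. False)"

definition complete :: "'a set \<Rightarrow> 'a graph" where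
  "complete S = (S, \<lambda>x y. x \<in> S \<and> y \<in> S \<and> x \<noteq> y)"

definition I_omega :: "nat graph" where "I_omega = edgeless UNIV"
definition K :: "nat \<Rightarrow> nat graph" where "K n = complete {..<n}"

definition lex_prod :: "'a graph \<Rightarrow> 'b graph \<Rightarrow> ('a \<times> 'b) graph" where
  "lex_prod G H = (verts G \<times> verts H,
     \<lambda>(g,h) (g',h'). (g,h) \<in> verts G \<times> verts H \<and> (g',h') \<in> verts G \<times> verts H \<and>
        (adj G g g' \<or> (g = g' \<and> adj H h h')))"

definition graph_iso :: "'a graph \<Rightarrow> 'b graph \<Rightarrow> bool" where
  "graph_iso G H \<longleftrightarrow> (\<exists>h. bij_betw h (verts G) (verts H) \<and>
     (\<forall>x\<in>verts G. \<forall>y\<in>verts G. adj G x y \<longleftrightarrow> adj H (h x) (h y)))"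

text \<open>X: homomorphism, monomorphism, isomorphism (onto image) between finite induced subgraphs.\<close>
datatype xkind = XH | XM | XI

definition local_morph :: "xkind \<Rightarrow> 'a graph \<Rightarrow> 'a set \<Rightarrow> ('a \<Rightarrow> 'a) \<Rightarrow> bool" where
  "local_morph X G A f \<longleftrightarrow>
     (\<forall>x\<in>A. f x \<in> verts G) \<and>
     (\<forall>x\<in>A. \<forall>y\<in>A. adj G x y \<longrightarrow> adj G (f x) (f y)) \<and>
     (X \<noteq> XH \<longrightarrow> inj_on f A) \<and>
     (X = XI \<longrightarrow> (\<forall>x\<in>A. \<forall>y\<in>A. adj G (f x) (f y) \<longrightarrow> adj G x y))"

text \<open>Y: endomorphism, self-embedding, automorphism, epimorphism, bimorphism, monomorphism.\<close>
datatype ykind = YH | YI | YA | YE | YB | YM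

definition endo :: "'a graph \<Rightarrow> ('a \<Rightarrow> 'a) \<Rightarrow> bool" where
  "endo G g \<longleftrightarrow> (\<forall>x\<in>verts G. g x \<in> verts G) \<and>
     (\<forall>x\<in>verts G. \<forall>y\<in>verts G. adj G x y \<longrightarrow> adj G (g x) (g y))"

definition self_morph :: "ykind \<Rightarrow> 'a graph \<Rightarrow> ('a \<Rightarrow> 'a) \<Rightarrow> bool" where
  "self_morph Y G g \<longleftrightarrow> endo G g \<and>
     (case Y of
        YH \<Rightarrow> True
      | YI \<Rightarrow> inj_on g (verts G) \<and>
              (\<forall>x\<in>verts G. \<forall>y\<in>verts G. adj G (g x) (g y) \<longrightarrow> adj G x y)
      | YA \<Rightarrow> bij_betw g (verts G) (verts G) \<and>
              (\<forall>x\<in>verts G. \<forall>y\<in>verts G. adj G (g x) (g y) \<longrightarrow> adj G x y)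
      | YE \<Rightarrow> g ` verts G = verts G
      | YB \<Rightarrow> bij_betw g (verts G) (verts G)
      | YM \<Rightarrow> inj_on g (verts G))"

definition homogeneous :: "xkind \<Rightarrow> ykind \<Rightarrow> 'a graph \<Rightarrow> bool" where
  "homogeneous X Y G \<longleftrightarrow>
     (\<forall>A f. A \<subseteq> verts G \<and> finite A \<and> local_morph X G A f \<longrightarrow>
        (\<exists>g. self_morph Y G g \<and> (\<forall>x\<in>A. g x = f x)))"

end

theory Submission
  imports Defs "HOL-Library.Ramsey"
begin

text \<open>
  ME-homogeneity lets a bijective homomorphism between finite vertex sets carry a common neighbour
  forwards and, by surjectivity of the extension, a common non-neighbour backwards; hence bijective
  homomorphisms transfer cones both in the graph and in its complement. If neither adjacency nor
  non-adjacency is transitive on distinct vertices, this symmetric condition already forces every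
  finite set to have a cone in the graph and in the complement: Ramsey's theorem provides one of the
  two, and the other follows because a maximal size for stars is contradictory. Otherwise the graph
  is a disjoint union of cliques or complete multipartite, and counting classes under a surjective
  endomorphism leaves only the complete graph, infinitely many cliques of equal size, and infinitely
  many infinite parts. In each case one-point extensions of finite homomorphisms give a
  back-and-forth construction of an epimorphism, which is injective for injective data
  unless the graph consists of finite cliques of size at least two.
\<close>

section \<open>Cones\<close>

definition complement :: "'a graph \<Rightarrow> 'a graph" where
  "complement G = (verts G, \<lambda>x y. x \<in> verts G \<and> y \<in> verts G \<and> x \<noteq> y \<and> \<not> adj G x y)"

text \<open>As graphs are loopless, such a \<open>c\<close> lies outside \<open>U\<close>. Over
  \<open>complement G\<close> it is a vertex outside \<open>U\<close> with no neighbour in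
  \<open>U\<close>.\<close>

definition has_cone :: "'a graph \<Rightarrow> 'a set \<Rightarrow> bool" where
  "has_cone G U \<longleftrightarrow> (\<exists>c\<in>verts G. \<forall>u\<in>U. adj G c u)"

definition all_cones :: "'a graph \<Rightarrow> bool" where
  "all_cones G \<longleftrightarrow> (\<forall>U. finite U \<and> U \<subseteq> verts G \<longrightarrow> has_cone G U)"

text \<open>The bijection \<open>f\<close> may create edges, so \<open>B\<close> can carry more of
  them than \<open>A\<close>. Stated for an arbitrary graph, the property can be imposed on
  \<open>G\<close> and on \<open>complement G\<close> symmetrically.\<close>

definition cone_transfer :: "'a graph \<Rightarrow> bool" where
  "cone_transfer G \<longleftrightarrow> (\<forall>A B f. finite A \<and> A \<subseteq> verts G \<and> B \<subseteq> verts G \<and> bij_betw f A B \<and>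
     (\<forall>x\<in>A. \<forall>y\<in>A. adj G x y \<longrightarrow> adj G (f x) (f y)) \<and> has_cone G A \<longrightarrow> has_cone G B)"

definition independent :: "'a graph \<Rightarrow> 'a set \<Rightarrow> bool" where
  "independent G X \<longleftrightarrow> X \<subseteq> verts G \<and> (\<forall>x\<in>X. \<forall>y\<in>X. \<not> adj G x y)"

text \<open>For a graph this makes "equal or adjacent" an equivalence relation, so \<open>G\<close>
  is a disjoint union of cliques; for \<open>complement G\<close> it makes \<open>G\<close> complete
  multipartite.\<close>

definition clustered :: "'a graph \<Rightarrow> bool" where
  "clustered G \<longleftrightarrow> (\<forall>x y z. adj G x y \<and> adj G y z \<and> x \<noteq> z \<longrightarrow> adj G x z)"

lemma verts_complement [simp]: "verts (complement G) = verts G"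
  by (simp add: complement_def verts_def)

lemma adj_complement [simp]:
  "adj (complement G) x y \<longleftrightarrow> x \<in> verts G \<and> y \<in> verts G \<and> x \<noteq> y \<and> \<not> adj G x y"
  by (simp add: complement_def adj_def)

lemma adj_sym: "is_graph G \<Longrightarrow> adj G x y \<Longrightarrow> adj G y x"
  and adj_irrefl: "is_graph G \<Longrightarrow> \<not> adj G x x"
  and adj_verts: "is_graph G \<Longrightarrow> adj G x y \<Longrightarrow> x \<in> verts G \<and> y \<in> verts G"
  by (auto simp: is_graph_def)

lemma is_graph_complement: "is_graph G \<Longrightarrow> is_graph (complement G)"
  by (auto simp: is_graph_def)

lemma complement_complement: "is_graph G \<Longrightarrow> complement (complement G) = G"
  by (cases G) (auto simp: complement_def is_graph_def verts_def adj_def fun_eq_iff)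

lemma independent_insert:
  assumes "is_graph G"
  shows "independent G (insert a X) \<longleftrightarrow>
    independent G X \<and> a \<in> verts G \<and> (\<forall>x\<in>X. \<not> adj G a x)"
  using adj_sym[OF assms] adj_irrefl[OF assms] unfolding independent_def by blast

lemma has_cone_complement:
  assumes "has_cone (complement G) U"
  obtains z where "z \<in> verts G" "z \<notin> U" "\<And>u. u \<in> U \<Longrightarrow> \<not> adj G z u"
  using assms by (auto simp: has_cone_def)

text \<open>Vertices are added one at a time, each a cone in \<open>complement G\<close> over
  \<open>U\<close> and the vertices already chosen.\<close>

lemma generic_independent_set:
  assumes g: "is_graph G" and co: "all_cones (complement G)"
    and U: "finite U" "U \<subseteq> verts G"
  obtains Z where "independent G Z" "finite Z" "card Z = n" "Z \<inter> U = {}"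
    "\<And>z u. z \<in> Z \<Longrightarrow> u \<in> U \<Longrightarrow> \<not> adj G z u"
proof -
  have "\<exists>Z. independent G Z \<and> finite Z \<and> card Z = n \<and> Z \<inter> U = {} \<and> (\<forall>z\<in>Z. \<forall>u\<in>U. \<not> adj G z u)"
  proof (induction n)
    case 0
    show ?case by (rule exI[of _ "{}"]) (auto simp: independent_def)
  next
    case (Suc n)
    then obtain Z where Z: "independent G Z" "finite Z" "card Z = n" "Z \<inter> U = {}"
      "\<forall>z\<in>Z. \<forall>u\<in>U. \<not> adj G z u" by blast
    have "has_cone (complement G) (U \<union> Z)"
      using co U Z by (auto simp: all_cones_def independent_def)
    then obtain z where z: "z \<in> verts G" "z \<notin> U \<union> Z" "\<And>u. u \<in> U \<union> Z \<Longrightarrow> \<not> adj G z u"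
      by (rule has_cone_complement) blast
    then have "independent G (insert z Z)"
      using Z by (simp add: independent_insert[OF g])
    then show ?case
      using Z z by (intro exI[of _ "insert z Z"]) auto
  qed
  then show thesis using that by blast
qed

lemma cone_transferD:
  assumes "cone_transfer G" "finite A" "A \<subseteq> verts G" "B \<subseteq> verts G" "bij_betw f A B"
    "\<And>x y. x \<in> A \<Longrightarrow> y \<in> A \<Longrightarrow> adj G x y \<Longrightarrow> adj G (f x) (f y)" "has_cone G A"
  shows "has_cone G B"
  using assms(1)[unfolded cone_transfer_def, rule_format, of A B f] assms(2-) by simp

text \<open>The vertices of \<open>X\<close> have no edges among themselves or to \<open>C\<close>,
  so \<open>f\<close> combined with any bijection from \<open>X\<close> onto \<open>Z\<close> is a
  homomorphism. The target may have arbitrary edges inside \<open>Z\<close> and between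
  \<open>Z\<close> and \<open>C'\<close>.\<close>

lemma cone_transfer_core:
  assumes g: "is_graph G" and ct: "cone_transfer G"
    and C: "finite C" "C \<subseteq> verts G" "C' \<subseteq> verts G" "bij_betw f C C'"
      "\<And>x y. x \<in> C \<Longrightarrow> y \<in> C \<Longrightarrow> adj G x y \<Longrightarrow> adj G (f x) (f y)"
    and X: "independent G X" "finite X" "X \<inter> C = {}"
      "\<And>x u. x \<in> X \<Longrightarrow> u \<in> C \<Longrightarrow> \<not> adj G x u"
    and Z: "Z \<subseteq> verts G" "finite Z" "card Z = card X" "Z \<inter> C' = {}"
    and cone: "has_cone G (C \<union> X)"
  shows "has_cone G (C' \<union> Z)"
proof -
  obtain h where h: "bij_betw h X Z"
    using X Z finite_same_card_bij by metis
  define k where "k x = (if x \<in> C then f x else h x)" for x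
  have "bij_betw k C C'" using C(4) by (rule bij_betw_cong[THEN iffD1, rotated]) (simp add: k_def)
  moreover have "bij_betw k X Z"
    using h by (rule bij_betw_cong[THEN iffD1, rotated]) (use X in \<open>auto simp: k_def\<close>)
  ultimately have "bij_betw k (C \<union> X) (C' \<union> Z)"
    using Z by (intro bij_betw_combine) auto
  moreover have "adj G (k x) (k y)" if "x \<in> C \<union> X" "y \<in> C \<union> X" "adj G x y" for x y
  proof -
    have "x \<in> C \<and> y \<in> C"
      using that X(1,4) adj_sym[OF g] unfolding independent_def by blast
    then show ?thesis using that(3) C(5) by (simp add: k_def)
  qed
  moreover have "finite (C \<union> X)" "C \<union> X \<subseteq> verts G" "C' \<union> Z \<subseteq> verts G"
    using C X Z by (auto simp: independent_def)
  ultimately show ?thesis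
    using cone cone_transferD[OF ct, of "C \<union> X" "C' \<union> Z" k] by blast
qed

text \<open>
  The cone \<open>c\<close> over \<open>s\<close> independent vertices, together with generic (non-adjacent to everything
  chosen so far) vertices, produces cones over
  \<open>K\<^sub>2 + (s-1) K\<^sub>1\<close>, \<open>K\<^sub>3 + (s-1) K\<^sub>1\<close> and \<open>2 K\<^sub>2 + (s-2) K\<^sub>1\<close>. The last covers an induced path
  \<open>y, c, e, z\<close> plus generic vertices; a cone \<open>k\<close> over it and a cone \<open>d\<close> over the triangle \<open>k, c, e\<close>
  with generic vertices then yield an independent set of size \<open>s + 1\<close> in the neighbourhood of \<open>k\<close>.
\<close>

lemma no_maximal_star:
  assumes g: "is_graph G" and ct: "cone_transfer G" and co: "all_cones (complement G)"
    and X: "independent G X" "finite X" "card X = s" "has_cone G X" and s: "s \<ge> 2"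
    and bound: "\<And>Y. independent G Y \<Longrightarrow> finite Y \<Longrightarrow> has_cone G Y \<Longrightarrow> card Y \<le> s"
  shows False
proof -
  note sym = adj_sym[OF g] and irr = adj_irrefl[OF g] and av = adj_verts[OF g]
  note gen = generic_independent_set[OF g co]
  have XV: "X \<subseteq> verts G" using X by (simp add: independent_def)
  \<comment> \<open>Generic neighbours of \<open>d\<close> use up all but one of the \<open>s\<close> available independent ones.\<close>
  have cl: "adj G a b"
    if "independent G Z" "finite Z" "card Z = s - 1" "\<And>z. z \<in> Z \<Longrightarrow> adj G d z"
      "adj G d a" "adj G d b" "a \<noteq> b" "a \<notin> Z" "b \<notin> Z"
      "\<And>z. z \<in> Z \<Longrightarrow> \<not> adj G z a" "\<And>z. z \<in> Z \<Longrightarrow> \<not> adj G z b" for d a b Z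
  proof (rule ccontr)
    assume n: "\<not> adj G a b"
    have "independent G (insert a (insert b Z))"
      using that n sym irr av unfolding independent_def by blast
    moreover have "has_cone G (insert a (insert b Z))"
      using that av unfolding has_cone_def by blast
    ultimately have "card (insert a (insert b Z)) \<le> s" using that bound by blast
    then show False using that s by simp
  qed
  obtain c where c: "c \<in> verts G" "\<And>x. x \<in> X \<Longrightarrow> adj G c x"
    using X by (auto simp: has_cone_def)
  have cX: "c \<notin> X" using c irr by blast
  note ins = independent_insert[OF g]
  have star: "card Y \<le> s" if "\<And>x. x \<in> Y \<Longrightarrow> adj G d x" "independent G Y"
    "finite Y" "d \<in> verts G" for d Y
    using that bound[of Y] unfolding has_cone_def by blast

  obtain Z where Z: "independent G Z" "finite Z" "card Z = s - 1" "Z \<inter> insert c X = {}"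
    "\<And>z u. z \<in> Z \<Longrightarrow> u \<in> insert c X \<Longrightarrow> \<not> adj G z u"
    using gen[of "insert c X"] c X XV by (metis finite_insert insert_subset)
  \<comment> \<open>\<open>c\<close> and the \<open>s - 1\<close> vertices of \<open>Z\<close>
    together match the size of \<open>X\<close>, whose cone transfers to them along any
    bijection.\<close>
  have "has_cone G ({} \<union> insert c Z)"
    by (rule cone_transfer_core[OF g ct, where C = "{}" and f = id and X = X])
      (use X Z c s in \<open>auto simp: independent_def\<close>)
  then obtain e where e: "e \<in> verts G" "adj G e c" "\<And>z. z \<in> Z \<Longrightarrow> adj G e z"
    by (auto simp: has_cone_def)
  obtain z where z: "z \<in> Z" using Z s by fastforce
  have eX: "e \<notin> X" "e \<noteq> c" using e Z z sym by blast+
  \<comment> \<open>Otherwise \<open>e\<close> could be added to \<open>X\<close>, giving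
    \<open>s + 1\<close> independent neighbours of \<open>c\<close>.\<close>
  have "\<exists>x\<in>X. adj G e x"
  proof (rule ccontr)
    assume "\<not> ?thesis"
    then have "card (insert e X) \<le> s"
      using X c e sym by (intro star[of _ c]) (auto simp: ins)
    then show False using eX X by simp
  qed
  then obtain x where x: "x \<in> X" "adj G e x" by blast
  define Y where "Y = X - {x}"
  have Y: "independent G Y" "finite Y" "card Y = s - 1" "Y \<subseteq> X" "x \<notin> Y"
    using X x by (auto simp: Y_def independent_def)
  \<comment> \<open>A second neighbour of \<open>e\<close> in \<open>X\<close> would be joined to
    \<open>x\<close> by \<open>cl\<close>, applied at \<open>e\<close> with the generic set
    \<open>Z\<close>.\<close>
  have eY: "\<not> adj G e y" "\<not> adj G x y" if "y \<in> Y" for y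
  proof -
    show "\<not> adj G x y" using that X x Y by (auto simp: independent_def)
    then show "\<not> adj G e y"
      using cl[OF Z(1,2,3), of e x y] that e x Y Z by blast
  qed
  have eY': "\<not> adj G y e" "\<not> adj G y x" if "y \<in> Y" for y
    using eY[OF that] sym by blast+
  have xe: "adj G x e" "x \<noteq> e" "e \<noteq> x" "adj G c x" "adj G c e"
    using x e c eX sym by auto
  have coneY: "adj G c y" if "y \<in> Y" for y using that Y c by blast
  \<comment> \<open>The source lies in the neighbourhood of \<open>c\<close>: the edge between
    \<open>x\<close> and \<open>e\<close>, and the \<open>s - 1\<close> vertices of
    \<open>Y\<close>, which have no edges to it.\<close>
  have K2: "has_cone G ({p, q} \<union> T)"
    if "adj G p q" "T \<subseteq> verts G" "finite T" "card T = s - 1" "T \<inter> {p, q} = {}" for p q T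
    by (rule cone_transfer_core[OF g ct, where C = "{x, e}" and f = "(\<lambda>_. p)(e := q)" and X = Y])
      (use that x e eX Y eY' xe coneY c XV irr sym[OF that(1)] av[OF that(1)] in
        \<open>auto simp: bij_betw_def has_cone_def intro!: bexI[of _ c]\<close>)

  obtain T where T: "independent G T" "finite T" "card T = s - 1" "T \<inter> insert c (insert e X) = {}"
    "\<And>z u. z \<in> T \<Longrightarrow> u \<in> insert c (insert e X) \<Longrightarrow> \<not> adj G z u"
    using gen[of "insert c (insert e X)"] c e X XV by (metis finite_insert insert_subset)
  obtain t where t: "t \<in> T" using T s by fastforce
  have TV: "T \<subseteq> verts G" using T by (simp add: independent_def)
  \<comment> \<open>The new cone vertex \<open>r\<close> is adjacent to the generic set
    \<open>T\<close>, which lets \<open>cl\<close> control its other neighbours.\<close>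
  have "has_cone G ({c, x} \<union> T)"
    by (rule K2) (use T TV x c in auto)
  then obtain r where r: "adj G r c" "adj G r x" "\<And>z. z \<in> T \<Longrightarrow> adj G r z" "r \<in> verts G"
    by (auto simp: has_cone_def)
  have rne: "r \<notin> X" "r \<noteq> e" "r \<noteq> c" using r t T sym by blast+
  have rY: "\<not> adj G r y" if "y \<in> Y" for y
  proof
    assume a: "adj G r y"
    have "adj G x y"
      by (rule cl[OF T(1,2,3), of r]) (use a r T x Y that in auto)
    then show False using eY that by blast
  qed
  \<comment> \<open>Otherwise \<open>r\<close>, \<open>e\<close> and \<open>Y\<close> would be
    \<open>s + 1\<close> independent neighbours of \<open>c\<close>.\<close>
  have re: "adj G r e"
  proof (rule ccontr)
    assume "\<not> ?thesis"
    then have "card (insert r (insert e Y)) \<le> s"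
      using Y coneY c(1) e(1) r(4) eY rY xe sym[OF r(1)] by (intro star[of _ c]) (auto simp: ins)
    moreover have "r \<notin> insert e Y" "e \<notin> Y" using rne eX Y by auto
    ultimately show False using Y s by simp
  qed
  have rY': "\<not> adj G y r" if "y \<in> Y" for y
    using rY[OF that] sym by blast
  have re': "adj G e r" "adj G x r" "adj G c r" "x \<noteq> r" "r \<noteq> x"
    using re r sym rne x by blast+
  \<comment> \<open>The source is now the triangle \<open>x\<close>, \<open>e\<close>,
    \<open>r\<close> in the neighbourhood of \<open>c\<close>, with no edges to
    \<open>Y\<close>.\<close>
  have K3: "has_cone G ({p, q, w} \<union> S)"
    if "adj G p q" "adj G p w" "adj G q w" "S \<subseteq> verts G" "finite S" "card S = s - 1"
      "S \<inter> {p, q, w} = {}" for p q w S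
    by (rule cone_transfer_core[OF g ct, where C = "{x, e, r}" and f = "(\<lambda>_. p)(e := q, r := w)" and X = Y])
      (use that x e eX Y eY' xe coneY c XV irr r rY' rne re re' av[OF that(1)] av[OF that(2)]
        sym[OF that(1)] sym[OF that(2)] sym[OF that(3)] in
        \<open>auto simp: bij_betw_def has_cone_def intro!: bexI[of _ c]\<close>)

  obtain y where y: "y \<in> Y" using Y s by fastforce
  define W where "W = Y - {y}"
  have W: "independent G W" "finite W" "card W = s - 2" "W \<subseteq> Y" "y \<notin> W"
    using Y y by (auto simp: W_def independent_def)
  have yX: "y \<in> X" "y \<noteq> x" using y Y by auto
  \<comment> \<open>The construction of \<open>r\<close> is repeated with \<open>y\<close> in place
    of \<open>x\<close>; by \<open>cl\<close> the resulting \<open>q\<close> is adjacent to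
    \<open>y\<close> but to no other vertex of \<open>X\<close> and not to \<open>e\<close>.\<close>
  have "has_cone G ({c, y} \<union> T)"
    by (rule K2) (use T TV yX c in auto)
  then obtain q where q: "adj G q c" "adj G q y" "\<And>z. z \<in> T \<Longrightarrow> adj G q z" "q \<in> verts G"
    by (auto simp: has_cone_def)
  have qne: "q \<notin> X" "q \<noteq> e" "q \<noteq> c" using q t T sym by blast+
  have qX: "\<not> adj G q u" if "u \<in> insert e X" "u \<noteq> y" for u
  proof
    assume a: "adj G q u"
    have "adj G y u"
      by (rule cl[OF T(1,2,3), of q]) (use a q T yX that in auto)
    then show False using that eY y X yX sym by (auto simp: independent_def)
  qed
  have nadj: "\<not> adj G u v" if "u \<in> X" "v \<in> X" for u v
    using X that by (auto simp: independent_def)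
  \<comment> \<open>The edges \<open>x\<close>-\<open>e\<close> and
    \<open>y\<close>-\<open>q\<close> lie in the neighbourhood of \<open>c\<close>, and no edge
    joins them to each other or to \<open>W\<close>.\<close>
  have K22: "has_cone G ({p, p', w, w'} \<union> S)"
    if p: "adj G p p'" "adj G w w'" "distinct [p, p', w, w']" "S \<subseteq> verts G" "finite S" "card S = s - 2"
      "S \<inter> {p, p', w, w'} = {}" for p p' w w' S
  proof (rule cone_transfer_core[OF g ct, where C = "{x, e, y, q}"
        and f = "(\<lambda>_. p)(e := p', y := w, q := w')" and X = W])
    have *: "x \<noteq> e" "x \<noteq> q" "e \<noteq> y" "q \<noteq> y" "q \<noteq> e" using x eX qne yX by auto
    show "bij_betw ((\<lambda>_. p)(e := p', y := w, q := w')) {x, e, y, q} {p, p', w, w'}"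
      using p(3) * yX by (auto simp: bij_betw_def)
    show "{x, e, y, q} \<subseteq> verts G" using x yX e q XV by auto
    show "{p, p', w, w'} \<subseteq> verts G" using av[OF p(1)] av[OF p(2)] by blast
    have n: "\<not> adj G x y" "\<not> adj G e y" "\<not> adj G q x" "\<not> adj G q e"
      "\<not> adj G y x" "\<not> adj G y e" "\<not> adj G x q" "\<not> adj G e q"
      using nadj x yX eY y qX * sym by blast+
    show "adj G (((\<lambda>_. p)(e := p', y := w, q := w')) u) (((\<lambda>_. p)(e := p', y := w, q := w')) v)"
      if "u \<in> {x, e, y, q}" "v \<in> {x, e, y, q}" "adj G u v" for u v
      using that n irr * yX p(1,2) sym[OF p(1)] sym[OF p(2)] by auto
    show "W \<inter> {x, e, y, q} = {}" using W Y eX qne by auto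
    show "\<not> adj G v u" if "v \<in> W" "u \<in> {x, e, y, q}" for u v
    proof -
      have "v \<in> Y" "v \<in> X" "v \<noteq> y" using that W Y by auto
      moreover from this have "\<not> adj G q v" using qX by blast
      ultimately show ?thesis using that(2) nadj[of v] eY'[of v] x(1) yX(1) sym[of v q] by auto
    qed
    show "has_cone G ({x, e, y, q} \<union> W)"
      unfolding has_cone_def using c(1) xe(4,5) coneY y sym[OF q(1)] W(4) by (intro bexI[of _ c]) auto
  qed (use p W in auto)

  have zp: "\<not> adj G z c" "\<not> adj G z y" "z \<noteq> c" "z \<noteq> y" "z \<in> verts G" "adj G e z"
    using Z(4,5) z yX e av by blast+
  have yc: "adj G y c" "\<not> adj G e y" "e \<noteq> y" "e \<noteq> z" "y \<noteq> c" "y \<in> verts G"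
    using yX c sym eY y e zp irr eX cX XV by blast+
  obtain J where J: "independent G J" "finite J" "card J = s - 2" "J \<inter> {y, c, e, z} = {}"
    "\<And>j u. j \<in> J \<Longrightarrow> u \<in> {y, c, e, z} \<Longrightarrow> \<not> adj G j u"
    using gen[of "{y, c, e, z}" "s - 2"] c e zp yc by auto
  have JV: "J \<subseteq> verts G" using J by (simp add: independent_def)
  \<comment> \<open>\<open>K22\<close> prescribes only the two outer edges of the path
    \<open>y\<close>, \<open>c\<close>, \<open>e\<close>, \<open>z\<close>; its middle edge is one
    that the target has in addition.\<close>
  have "has_cone G ({y, c, e, z} \<union> J)"
    by (rule K22) (use yc zp eX JV J in auto)
  then obtain k where k: "k \<in> verts G" "adj G k y" "adj G k c" "adj G k e" "adj G k z"
    "\<And>j. j \<in> J \<Longrightarrow> adj G k j"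
    by (auto simp: has_cone_def)
  obtain S where S: "independent G S" "finite S" "card S = s - 1" "S \<inter> ({k, y, c, e, z} \<union> J) = {}"
    "\<And>j u. j \<in> S \<Longrightarrow> u \<in> {k, y, c, e, z} \<union> J \<Longrightarrow> \<not> adj G j u"
    using gen[of "{k, y, c, e, z} \<union> J" "s - 1"] c e zp yc J JV k by auto
  obtain u where u: "u \<in> S" using S s by fastforce
  have SV: "S \<subseteq> verts G" using S by (simp add: independent_def)
  have "has_cone G ({k, c, e} \<union> S)"
    by (rule K3) (use k e S SV sym in auto)
  then obtain d where d: "adj G d k" "adj G d c" "adj G d e" "\<And>j. j \<in> S \<Longrightarrow> adj G d j" "d \<in> verts G"
    by (auto simp: has_cone_def)
  have dne: "d \<notin> {k, y, c, e, z} \<union> J" using d(4)[OF u] S(5)[OF u] sym by blast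
  \<comment> \<open>By \<open>cl\<close> at \<open>d\<close>, with the generic set \<open>S\<close>,
    a neighbour of \<open>d\<close> in \<open>J\<close> would be adjacent to \<open>c\<close>. In
    the same way \<open>y\<close> would be adjacent to \<open>e\<close>, and \<open>z\<close> to
    \<open>c\<close>.\<close>
  have "\<not> adj G d j" if "j \<in> J" for j
  proof
    assume a: "adj G d j"
    have "adj G c j"
      by (rule cl[OF S(1,2,3), of d]) (use a d S J that in auto)
    then show False using J that sym by blast
  qed
  moreover have "\<not> adj G d y"
  proof
    assume a: "adj G d y"
    have "adj G e y"
      by (rule cl[OF S(1,2,3), of d]) (use a d S yc in auto)
    then show False using yc by blast
  qed
  moreover have "\<not> adj G d z"
  proof
    assume a: "adj G d z"
    have "adj G c z"
      by (rule cl[OF S(1,2,3), of d]) (use a d S zp in auto)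
    then show False using zp sym by blast
  qed
  moreover have yz: "\<not> adj G y z" using zp sym by blast
  moreover have yJ: "\<forall>j\<in>J. \<not> adj G y j" and zJ: "\<forall>j\<in>J. \<not> adj G z j" using J(5) sym by blast+
  \<comment> \<open>The vertices \<open>d\<close>, \<open>y\<close>, \<open>z\<close> and the
    \<open>s - 2\<close> elements of \<open>J\<close> are \<open>s + 1\<close> independent
    neighbours of \<open>k\<close>.\<close>
  ultimately have "card (insert d (insert y (insert z J))) \<le> s"
    using d(5) k sym[OF d(1)] J zp yc yz yJ zJ by (intro star[of _ k]) (auto simp: ins)
  moreover have "d \<notin> insert y (insert z J)" "y \<notin> insert z J" "z \<notin> J" using dne J zp by auto
  ultimately show False using J s by simp
qed

section \<open>From unbounded stars to cones over all finite sets\<close>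

definition large_stars :: "'a graph \<Rightarrow> bool" where
  "large_stars G \<longleftrightarrow> (\<forall>n. \<exists>X. independent G X \<and> finite X \<and> n \<le> card X \<and> has_cone G X)"

text \<open>On an independent set every map into the vertices is a homomorphism. Enough leaves of a
  large star, matched bijectively with \<open>U\<close>, transfer their cone to
  \<open>U\<close>.\<close>

lemma large_stars_imp_all_cones:
  assumes ct: "cone_transfer G" and ls: "large_stars G"
  shows "all_cones G"
  unfolding all_cones_def
proof (intro allI impI)
  fix U assume U: "finite U \<and> U \<subseteq> verts G"
  obtain X where X: "independent G X" "finite X" "card U \<le> card X" "has_cone G X"
    using ls unfolding large_stars_def by blast
  obtain Y where Y: "Y \<subseteq> X" "card Y = card U" "finite Y"
    using obtain_subset_with_card_n[OF X(3)] by blast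
  obtain f where f: "bij_betw f Y U"
    using finite_same_card_bij[OF Y(3) _ Y(2)] U by blast
  have "has_cone G Y" using X Y by (auto simp: has_cone_def)
  moreover have "Y \<subseteq> verts G" "\<forall>x\<in>Y. \<forall>y\<in>Y. \<not> adj G x y"
    using X(1) Y(1) by (auto simp: independent_def)
  ultimately show "has_cone G U"
    using f Y U cone_transferD[OF ct, of Y U f] by blast
qed

text \<open>An induced path on three vertices is a star with two leaves. If star sizes were bounded,
  their maximum would be at least 2, against \<open>no_maximal_star\<close>.\<close>

lemma large_stars_if_not_clustered:
  assumes g: "is_graph G" and ct: "cone_transfer G" and co: "all_cones (complement G)"
    and nc: "\<not> clustered G"
  shows "large_stars G"
proof (rule ccontr)
  assume "\<not> large_stars G"
  then obtain n where n: "\<And>X. independent G X \<Longrightarrow> finite X \<Longrightarrow> has_cone G X \<Longrightarrow> card X < n"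
    unfolding large_stars_def by (meson not_le)
  define S where "S = {card X |X. independent G X \<and> finite X \<and> has_cone G X}"
  have "S \<subseteq> {..<n}" using n by (auto simp: S_def)
  then have fin: "finite S" by (rule finite_subset) simp
  obtain a b c where abc: "adj G a b" "adj G b c" "a \<noteq> c" "\<not> adj G a c"
    using nc unfolding clustered_def by blast
  have "independent G {a, c}" "has_cone G {a, c}"
    using abc adj_sym[OF g abc(1)] adj_sym[OF g, of c a] adj_irrefl[OF g] adj_verts[OF g abc(1)]
      adj_verts[OF g abc(2)] by (auto simp: independent_def has_cone_def)
  then have "card {a, c} \<in> S" unfolding S_def by blast
  then have two: "2 \<in> S" using abc(3) by (simp add: numeral_2_eq_2)
  then have "Max S \<in> S" "2 \<le> Max S" using fin Max_in[of S] Max_ge[of S 2] by blast+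
  then obtain X where "independent G X" "finite X" "card X = Max S" "has_cone G X"
    unfolding S_def by auto
  then show False
    by (rule no_maximal_star[OF g ct co]) (use fin \<open>2 \<le> Max S\<close> in \<open>auto simp: S_def intro: Max_ge\<close>)
qed

text \<open>If some \<open>u\<close> missed infinitely many vertices of the clique \<open>C\<close>,
  finite sets of these would be independent in \<open>complement G\<close> with cone
  \<open>u\<close>, giving large stars there. So each \<open>u\<close> in \<open>U\<close> misses
  only finitely many, and some vertex of \<open>C\<close> is adjacent to all of
  \<open>U\<close>.\<close>

lemma infinite_clique_imp_all_cones:
  assumes g: "is_graph G" and C: "infinite C" "C \<subseteq> verts G"
    "\<And>x y. x \<in> C \<Longrightarrow> y \<in> C \<Longrightarrow> x \<noteq> y \<Longrightarrow> adj G x y"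
    and ns: "\<not> large_stars (complement G)"
  shows "all_cones G"
  unfolding all_cones_def
proof (intro allI impI)
  fix U assume U: "finite U \<and> U \<subseteq> verts G"
  have fin: "finite {c \<in> C. \<not> adj G u c}" if u: "u \<in> U" for u
  proof (rule ccontr)
    assume "infinite {c \<in> C. \<not> adj G u c}"
    then have inf: "infinite ({c \<in> C. \<not> adj G u c} - {u})" by simp
    have "\<exists>X. independent (complement G) X \<and> finite X \<and> n \<le> card X \<and> has_cone (complement G) X" for n
    proof -
      obtain X where X: "X \<subseteq> {c \<in> C. \<not> adj G u c} - {u}" "finite X" "card X = n"
        using infinite_arbitrarily_large[OF inf] by blast
      then have XC: "x \<in> C \<and> x \<in> verts G \<and> \<not> adj G u x \<and> x \<noteq> u" if "x \<in> X" for x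
        using that C(2) by blast
      have "independent (complement G) X"
        using XC C(3) unfolding independent_def by auto
      moreover have "has_cone (complement G) X"
        using XC U u unfolding has_cone_def by (intro bexI[of _ u]) auto
      ultimately show ?thesis using X by blast
    qed
    then show False using ns unfolding large_stars_def by blast
  qed
  then have "infinite (C - (\<Union>u\<in>U. {c \<in> C. \<not> adj G u c}))"
    using C(1) U by (intro Diff_infinite_finite) auto
  then obtain c where "c \<in> C - (\<Union>u\<in>U. {c \<in> C. \<not> adj G u c})"
    by (metis ex_in_conv finite.emptyI)
  then show "has_cone G U"
    using C(2) adj_sym[OF g] unfolding has_cone_def by blast
qed

text \<open>Large stars on either side give all cones on that side; without them, an infinite clique
  or independent set does. Cones on one side then force large stars, hence all cones, on the
  other.\<close>

lemma all_cones_in_graph_and_complement: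
  assumes g: "is_graph G" and inf: "infinite (verts G)"
    and ct: "cone_transfer G" "cone_transfer (complement G)"
    and nc: "\<not> clustered G" "\<not> clustered (complement G)"
  shows "all_cones G \<and> all_cones (complement G)"
proof -
  note g' = is_graph_complement[OF g] and cc = complement_complement[OF g]
  have "all_cones G \<or> all_cones (complement G)"
  proof (cases "large_stars G \<or> large_stars (complement G)")
    case True
    then show ?thesis using large_stars_imp_all_cones ct by blast
  next
    case False
    \<comment> \<open>The Ramsey colouring of pairs: colour 0 is an edge, colour 1 a
      non-edge.\<close>
    define f where "f e = (if \<exists>x y. e = {x, y} \<and> adj G x y then 0 else 1 :: nat)" for e
    have f2: "f e < 2" for e by (simp add: f_def)
    have f: "f {x, y} = 0 \<longleftrightarrow> adj G x y" for x y
      using adj_sym[OF g] by (auto simp: f_def doubleton_eq_iff)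
    obtain C t where C: "C \<subseteq> verts G" "infinite C" "\<forall>x\<in>C. \<forall>y\<in>C. x \<noteq> y \<longrightarrow> f {x, y} = t"
      using Ramsey2[OF inf, of f 2] f2 by blast
    show ?thesis
    proof (cases "t = 0")
      case True
      then have "all_cones G"
        using C f False by (intro infinite_clique_imp_all_cones[OF g, of C]) auto
      then show ?thesis ..
    next
      case t: False
      have "\<not> adj G x y" if "x \<in> C" "y \<in> C" "x \<noteq> y" for x y
        using C(3) that t f[of x y] by auto
      then have "all_cones (complement G)"
        using C False by (intro infinite_clique_imp_all_cones[OF g', of C]) (auto simp: cc)
      then show ?thesis ..
    qed
  qed
  then show ?thesis
    using large_stars_if_not_clustered[OF g ct(1) _ nc(1)] large_stars_imp_all_cones[OF ct(1)]
      large_stars_if_not_clustered[OF g' ct(2) _ nc(2)] large_stars_imp_all_cones[OF ct(2)]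
    by (auto simp: cc)
qed

section \<open>Consequences of ME-homogeneity\<close>

lemma ME_extend:
  assumes "homogeneous XM YE G" "finite A" "A \<subseteq> verts G" "inj_on f A" "f ` A \<subseteq> verts G"
    "\<And>x y. x \<in> A \<Longrightarrow> y \<in> A \<Longrightarrow> adj G x y \<Longrightarrow> adj G (f x) (f y)"
  obtains g where "g ` verts G = verts G"
    "\<And>x y. x \<in> verts G \<Longrightarrow> y \<in> verts G \<Longrightarrow> adj G x y \<Longrightarrow> adj G (g x) (g y)"
    "\<And>x. x \<in> A \<Longrightarrow> g x = f x"
proof -
  have "local_morph XM G A f" using assms by (auto simp: local_morph_def)
  then obtain g where "self_morph YE G g" "\<forall>x\<in>A. g x = f x"
    using assms(1)[unfolded homogeneous_def, rule_format, of A f] assms(2,3) by blast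
  then show thesis by (intro that[of g]) (auto simp: self_morph_def endo_def)
qed

lemma ME_cone_transfer:
  assumes me: "homogeneous XM YE G"
  shows "cone_transfer G"
  unfolding cone_transfer_def
proof (intro allI impI, elim conjE)
  fix A B f
  assume A: "finite A" "A \<subseteq> verts G" and B: "B \<subseteq> verts G" and f: "bij_betw f A B"
    and hom: "\<forall>x\<in>A. \<forall>y\<in>A. adj G x y \<longrightarrow> adj G (f x) (f y)" and "has_cone G A"
  then obtain c where c: "c \<in> verts G" "\<And>a. a \<in> A \<Longrightarrow> adj G c a"
    by (auto simp: has_cone_def)
  obtain g where g: "g ` verts G = verts G"
    "\<And>x y. x \<in> verts G \<Longrightarrow> y \<in> verts G \<Longrightarrow> adj G x y \<Longrightarrow> adj G (g x) (g y)"
    "\<And>x. x \<in> A \<Longrightarrow> g x = f x"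
    using ME_extend[OF me A, of f] f B hom unfolding bij_betw_def by metis
  have "adj G (g c) (f a)" if "a \<in> A" for a
    using g(2)[of c a] g(3)[OF that] c that A by auto
  moreover have "B = f ` A" using f by (simp add: bij_betw_def)
  ultimately show "has_cone G B" using g(1) c unfolding has_cone_def by blast
qed

text \<open>Surjectivity pulls a vertex avoiding the image back to one avoiding the domain.\<close>

lemma ME_cone_transfer_complement:
  assumes g: "is_graph G" and me: "homogeneous XM YE G"
  shows "cone_transfer (complement G)"
  unfolding cone_transfer_def
proof (intro allI impI, elim conjE)
  fix A B f
  assume A: "finite A" "A \<subseteq> verts (complement G)" and B: "B \<subseteq> verts (complement G)"
    and f: "bij_betw f A B"
    and hom: "\<forall>x\<in>A. \<forall>y\<in>A. adj (complement G) x y \<longrightarrow> adj (complement G) (f x) (f y)"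
    and "has_cone (complement G) A"
  then obtain w where w: "w \<in> verts G" "w \<notin> A" "\<And>a. a \<in> A \<Longrightarrow> \<not> adj G w a"
    using has_cone_complement by metis
  define f' where "f' = inv_into A f"
  have f': "bij_betw f' B A" unfolding f'_def by (rule bij_betw_inv_into[OF f])
  have ff': "f (f' b) = b" if "b \<in> B" for b
    using that f unfolding f'_def by (simp add: bij_betw_inv_into_right)
  have "finite B" using A(1) f bij_betw_finite by blast
  \<comment> \<open>\<open>f\<close> preserves non-adjacency of distinct vertices, so its inverse
    preserves adjacency.\<close>
  moreover have "adj G (f' x) (f' y)" if "x \<in> B" "y \<in> B" "adj G x y" for x y
  proof (rule ccontr)
    assume n: "\<not> adj G (f' x) (f' y)"
    have m: "f' x \<in> A" "f' y \<in> A" using that f' by (auto simp: bij_betw_def)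
    have "x \<noteq> y" using that(3) adj_irrefl[OF g] by blast
    then have "f' x \<noteq> f' y" using that ff' by metis
    then have "adj (complement G) (f (f' x)) (f (f' y))" using hom m n A(2) by auto
    then show False using that ff' by simp
  qed
  ultimately obtain h where h: "h ` verts G = verts G"
    "\<And>x y. x \<in> verts G \<Longrightarrow> y \<in> verts G \<Longrightarrow> adj G x y \<Longrightarrow> adj G (h x) (h y)"
    "\<And>x. x \<in> B \<Longrightarrow> h x = f' x"
    using ME_extend[OF me, of B f'] f' A B unfolding bij_betw_def verts_complement by metis
  obtain v where v: "v \<in> verts G" "h v = w" using h(1) w(1) by (metis imageE)
  have "v \<noteq> b \<and> \<not> adj G v b" if "b \<in> B" for b
  proof -
    have "h b \<in> A" using that h(3) f' by (auto simp: bij_betw_def)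
    then show ?thesis using w v h(2)[of v b] that B by auto
  qed
  then show "has_cone (complement G) B"
    unfolding has_cone_def using v B by (intro bexI[of _ v]) auto
qed

section \<open>Sizes and numbers of cliques and of parts\<close>

definition class_of :: "'a graph \<Rightarrow> 'a \<Rightarrow> 'a set" where
  "class_of G x = {y \<in> verts G. y = x \<or> adj G x y}"

lemma class_of_eq_iff:
  assumes "is_graph G" "clustered G" "x \<in> verts G" "y \<in> verts G"
  shows "class_of G x = class_of G y \<longleftrightarrow> x = y \<or> adj G x y"
  using assms adj_sym[OF assms(1)] unfolding class_of_def clustered_def by blast

text \<open>For countable graphs this is infinitely many cliques of one common size, finite or
  infinite; finite size 1 is the edgeless graph.\<close>

definition uniform_clusters :: "'a graph \<Rightarrow> bool" where
  "uniform_clusters G \<longleftrightarrow> clustered G \<and> infinite (class_of G ` verts G) \<and>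
     ((\<forall>x\<in>verts G. infinite (class_of G x)) \<or>
      (\<exists>n. \<forall>x\<in>verts G. finite (class_of G x) \<and> card (class_of G x) = n))"

lemma finite_fibres_agree:
  assumes fin: "finite (p ` V)" and im: "q ` V = p ` V"
    and fib: "\<And>u v. u \<in> V \<Longrightarrow> v \<in> V \<Longrightarrow> p u = p v \<Longrightarrow> q u = q v"
    and uv: "u \<in> V" "v \<in> V" "q u = q v"
  shows "p u = p v"
proof -
  define t where "t a = q (SOME u. u \<in> V \<and> p u = a)" for a
  have t: "t (p w) = q w" if "w \<in> V" for w
  proof -
    have "(SOME u. u \<in> V \<and> p u = p w) \<in> V \<and> p (SOME u. u \<in> V \<and> p u = p w) = p w"
      by (rule someI[of _ w]) (simp add: that)
    then show ?thesis unfolding t_def using fib that by blast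
  qed
  then have "(\<lambda>w. t (p w)) ` V = q ` V" by (intro image_cong refl)
  then have "t ` p ` V = p ` V" by (simp add: image_image im)
  then have "inj_on t (p ` V)" using fin by (intro eq_card_imp_inj_on) auto
  moreover have "t (p u) = t (p v)" using t uv by simp
  ultimately show ?thesis using uv by (meson imageI inj_onD)
qed

text \<open>An extension of the map from \<open>x\<close> to \<open>y\<close> embeds the clique of
  \<open>x\<close> in that of \<open>y\<close>, because adjacent vertices never share an image; so
  finite sizes agree. With only finitely many cliques, an epimorphism would permute them, yet one
  can be made to merge two.\<close>

lemma ME_clustered:
  assumes g: "is_graph G" and inf: "infinite (verts G)" and me: "homogeneous XM YE G"
    and cl: "clustered G"
    and nc: "p \<in> verts G" "q \<in> verts G" "p \<noteq> q" "\<not> adj G p q"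
  shows "uniform_clusters G"
proof -
  note ceq = class_of_eq_iff[OF g cl]
  have size: "finite (class_of G x) \<and> card (class_of G x) \<le> card (class_of G y)"
    if xy: "x \<in> verts G" "y \<in> verts G" "finite (class_of G y)" for x y
  proof -
    obtain h where h: "h ` verts G = verts G"
      "\<And>x y. x \<in> verts G \<Longrightarrow> y \<in> verts G \<Longrightarrow> adj G x y \<Longrightarrow> adj G (h x) (h y)"
      "\<And>u. u \<in> {x} \<Longrightarrow> h u = y"
      by (rule ME_extend[OF me, of "{x}" "\<lambda>_. y"]) (use xy adj_irrefl[OF g] in auto)
    have "h ` class_of G x \<subseteq> class_of G y"
      using h xy by (force simp: class_of_def)
    moreover have "inj_on h (class_of G x)"
    proof (rule inj_onI, rule ccontr)
      fix u v assume uv: "u \<in> class_of G x" "v \<in> class_of G x" "h u = h v" "u \<noteq> v"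
      then have "adj G u v"
        using cl adj_sym[OF g] unfolding class_of_def clustered_def by blast
      then show False using h(2)[of u v] uv adj_irrefl[OF g] by (auto simp: class_of_def)
    qed
    ultimately show ?thesis
      using xy(3) inj_on_finite card_inj_on_le by metis
  qed
  have "infinite (class_of G ` verts G)"
  proof
    assume fin: "finite (class_of G ` verts G)"
    have "verts G \<subseteq> (\<Union>c\<in>class_of G ` verts G. c)" by (auto simp: class_of_def)
    then have "\<exists>x\<in>verts G. infinite (class_of G x)"
      using fin inf by (metis (no_types, lifting) finite_UN finite_subset imageE)
    then obtain x where x: "x \<in> verts G" "infinite (class_of G x)" by blast
    have "class_of G x \<noteq> {x}" using x by auto
    then obtain y where y: "adj G x y" using x by (auto simp: class_of_def)
    have xy: "x \<noteq> y" "y \<in> verts G" using y g by (auto simp: is_graph_def)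
    \<comment> \<open>The non-edge \<open>p\<close>, \<open>q\<close> is sent onto an edge of an
      infinite clique, so two cliques land in one.\<close>
    obtain h where h: "h ` verts G = verts G"
      "\<And>x y. x \<in> verts G \<Longrightarrow> y \<in> verts G \<Longrightarrow> adj G x y \<Longrightarrow> adj G (h x) (h y)"
      "\<And>u. u \<in> {p, q} \<Longrightarrow> h u = (if u = p then x else y)"
      by (rule ME_extend[OF me, of "{p, q}" "\<lambda>u. if u = p then x else y"])
        (use nc x xy adj_irrefl[OF g] adj_sym[OF g] in auto)
    have hV: "h u \<in> verts G" if "u \<in> verts G" for u using h(1) that by auto
    have "class_of G p = class_of G q"
    proof (rule finite_fibres_agree[where q = "\<lambda>u. class_of G (h u)", OF fin])
      show "(\<lambda>u. class_of G (h u)) ` verts G = class_of G ` verts G"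
        using h(1) by (metis image_image)
      show "class_of G (h u) = class_of G (h v)"
        if "u \<in> verts G" "v \<in> verts G" "class_of G u = class_of G v" for u v
        using that h(2) hV by (auto simp: ceq)
      show "class_of G (h p) = class_of G (h q)" using h(3) nc x xy y by (auto simp: ceq)
    qed (use nc in auto)
    then show False using nc by (simp add: ceq)
  qed
  moreover have "\<exists>n. \<forall>x\<in>verts G. finite (class_of G x) \<and> card (class_of G x) = n"
    if "y \<in> verts G" "finite (class_of G y)" for y
    using size[OF _ that] size[OF that(1)] by (meson le_antisym)
  ultimately show ?thesis using cl unfolding uniform_clusters_def by blast
qed

text \<open>Preimages of non-adjacent vertices under an endomorphism are non-adjacent. Hence a
  surjective one covers each part that contains the image of a vertex by the image of that vertex's
  part. The map \<open>h\<close> fixes \<open>a\<close> but moves \<open>c\<close> out of their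
  common part.\<close>

lemma ME_complement_clustered:
  assumes g: "is_graph G" and me: "homogeneous XM YE G"
    and cl: "clustered (complement G)" and nc: "\<not> clustered G"
  shows "infinite (class_of (complement G) ` verts G)"
    and "x \<in> verts G \<Longrightarrow> infinite (class_of (complement G) x)"
proof -
  let ?c = "class_of (complement G)"
  have ceq: "?c x = ?c y \<longleftrightarrow> \<not> adj G x y" if "x \<in> verts G" "y \<in> verts G" for x y
    using class_of_eq_iff[OF is_graph_complement[OF g] cl, of x y] that adj_irrefl[OF g] by auto
  have mem: "y \<in> ?c x \<longleftrightarrow> y \<in> verts G \<and> \<not> adj G x y" if "x \<in> verts G" for x y
    using that adj_irrefl[OF g] by (auto simp: class_of_def)
  obtain a b c where abc: "adj G a b" "adj G b c" "a \<noteq> c" "\<not> adj G a c"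
    using nc unfolding clustered_def by blast
  have V: "a \<in> verts G" "b \<in> verts G" "c \<in> verts G" "a \<noteq> b" "\<not> adj G c a"
    using abc g by (auto simp: is_graph_def)
  obtain h where h: "h ` verts G = verts G"
    "\<And>x y. x \<in> verts G \<Longrightarrow> y \<in> verts G \<Longrightarrow> adj G x y \<Longrightarrow> adj G (h x) (h y)"
    "\<And>u. u \<in> {a, c} \<Longrightarrow> h u = (if u = a then a else b)"
    by (rule ME_extend[OF me, of "{a, c}" "\<lambda>u. if u = a then a else b"])
      (use abc V adj_irrefl[OF g] in auto)
  have ha: "h a = a" "h c = b" using h(3) abc by auto
  have infa: "infinite (?c a)"
  proof
    assume fin: "finite (?c a)"
    \<comment> \<open>The part of \<open>a\<close> is covered without using \<open>c\<close>, which
      is impossible for a finite set.\<close>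
    have "?c a \<subseteq> h ` (?c a - {c})"
    proof
      fix w assume w: "w \<in> ?c a"
      then obtain v where v: "v \<in> verts G" "w = h v" using h(1) V by (metis imageE mem)
      have "v \<in> ?c a" using w v h(2)[of a v] ha V by (auto simp: mem)
      moreover have "v \<noteq> c" using w v ha V abc by (auto simp: mem)
      ultimately show "w \<in> h ` (?c a - {c})" using v by auto
    qed
    then have "card (?c a) \<le> card (?c a - {c})"
      using fin by (meson card_image_le card_mono finite_Diff finite_imageI le_trans)
    moreover have "c \<in> ?c a" using V abc by (auto simp: mem)
    ultimately show False using fin by (meson card_Diff1_less not_le)
  qed
  show "infinite (?c x)" if x: "x \<in> verts G"
  proof
    assume fin: "finite (?c x)"
    obtain k where k: "k ` verts G = verts G"
      "\<And>x y. x \<in> verts G \<Longrightarrow> y \<in> verts G \<Longrightarrow> adj G x y \<Longrightarrow> adj G (k x) (k y)"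
      "\<And>u. u \<in> {x} \<Longrightarrow> k u = a"
      by (rule ME_extend[OF me, of "{x}" "\<lambda>_. a"]) (use x V adj_irrefl[OF g] in auto)
    have "?c a \<subseteq> k ` ?c x"
    proof
      fix w assume w: "w \<in> ?c a"
      then obtain v where v: "v \<in> verts G" "w = k v" using k(1) V by (metis imageE mem)
      have "v \<in> ?c x" using w v k(2)[of x v] k(3) x V by (auto simp: mem)
      then show "w \<in> k ` ?c x" using v by auto
    qed
    then show False using infa fin finite_surj by blast
  qed
  show "infinite (?c ` verts G)"
  proof
    assume fin: "finite (?c ` verts G)"
    have hV: "h u \<in> verts G" if "u \<in> verts G" for u using h(1) that by auto
    have im: "(\<lambda>u. ?c (h u)) ` verts G = ?c ` verts G" using h(1) by (metis image_image)
    \<comment> \<open>The class of the image determines the class of the argument. With finitely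
      many classes the converse holds as well, although \<open>a\<close> and \<open>c\<close> share
      a class and their images do not.\<close>
    have "?c (h a) = ?c (h c)"
    proof (rule finite_fibres_agree[where p = "\<lambda>u. ?c (h u)" and q = ?c])
      show "?c u = ?c v" if "u \<in> verts G" "v \<in> verts G" "?c (h u) = ?c (h v)" for u v
        using that h(2)[of u v] hV by (auto simp: ceq)
    qed (use fin im V abc in \<open>auto simp: ceq\<close>)
    then show False using ha V abc by (simp add: ceq)
  qed
qed

section \<open>Back and forth\<close>

text \<open>\<open>P\<close> describes admissible finite maps. The last conclusion says that
  \<open>g\<close> agrees with such a map around every finite set, so properties tested on finitely
  many points pass to \<open>g\<close>.\<close>

lemma back_and_forth:
  fixes V :: "'a set" and f :: "'a \<Rightarrow> 'a"
  assumes cnt: "countable V" and ne: "V \<noteq> {}" and A: "finite A" "A \<subseteq> V" "P A f"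
    and fwd: "\<And>A f v. finite A \<Longrightarrow> A \<subseteq> V \<Longrightarrow> P A f \<Longrightarrow> v \<in> V - A \<Longrightarrow> \<exists>w. P (insert v A) (f(v := w))"
    and bwd: "\<And>A f w. finite A \<Longrightarrow> A \<subseteq> V \<Longrightarrow> P A f \<Longrightarrow> w \<in> V - f ` A \<Longrightarrow>
      \<exists>v\<in>V - A. P (insert v A) (f(v := w))"
  obtains g where "\<And>x. x \<in> A \<Longrightarrow> g x = f x" "V \<subseteq> g ` V"
    "\<And>S. finite S \<Longrightarrow> S \<subseteq> V \<Longrightarrow> \<exists>B h. S \<subseteq> B \<and> P B h \<and> (\<forall>x\<in>B. g x = h x)"
proof -
  define Q where "Q p \<longleftrightarrow> finite (fst p) \<and> fst p \<subseteq> V \<and> P (fst p) (snd p)" for p :: "'a set \<times> ('a \<Rightarrow> 'a)"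
  define R where "R p q \<longleftrightarrow> fst p \<subseteq> fst q \<and> (\<forall>x\<in>fst p. snd q x = snd p x)"
    for p q :: "'a set \<times> ('a \<Rightarrow> 'a)"
  have Rrefl: "R p p" for p by (simp add: R_def)
  have Rtrans: "R p r" if "R p q" "R q r" for p q r
    using that unfolding R_def by (metis subset_iff)
  have dom: "\<exists>q. Q q \<and> R p q \<and> v \<in> fst q" if "Q p" "v \<in> V" for p v
  proof (cases "v \<in> fst p")
    case True
    then show ?thesis using that Rrefl by blast
  next
    case False
    then obtain w where "P (insert v (fst p)) ((snd p)(v := w))"
      using fwd[of "fst p" "snd p" v] \<open>Q p\<close> \<open>v \<in> V\<close> unfolding Q_def by blast
    then show ?thesis
      using that False
      by (intro exI[of _ "(insert v (fst p), (snd p)(v := w))"]) (auto simp: Q_def R_def)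
  qed
  have ran: "\<exists>q. Q q \<and> R p q \<and> w \<in> snd q ` fst q" if "Q p" "w \<in> V" for p w
  proof (cases "w \<in> snd p ` fst p")
    case True
    then show ?thesis using that Rrefl by blast
  next
    case False
    then obtain v where "v \<in> V - fst p" "P (insert v (fst p)) ((snd p)(v := w))"
      using bwd[of "fst p" "snd p" w] \<open>Q p\<close> \<open>w \<in> V\<close> unfolding Q_def by blast
    then show ?thesis
      using that False
      by (intro exI[of _ "(insert v (fst p), (snd p)(v := w))"]) (auto simp: Q_def R_def)
  qed
  have step: "\<exists>q. Q q \<and> R p q \<and> v \<in> fst q \<and> v \<in> snd q ` fst q" if p: "Q p" and v: "v \<in> V" for p v
  proof -
    obtain r where r: "Q r" "R p r" "v \<in> fst r" using dom[OF p v] by blast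
    obtain q where q: "Q q" "R r q" "v \<in> snd q ` fst q" using ran[OF r(1) v] by blast
    have "v \<in> fst q" using r q by (auto simp: R_def)
    then show ?thesis using q r Rtrans by blast
  qed
  define e where "e = from_nat_into V"
  have e: "range e = V" unfolding e_def using ne cnt by (rule range_from_nat_into)
  \<comment> \<open>Stage \<open>Suc n\<close> has the \<open>n\<close>-th vertex of the enumeration
    both in its domain and in its range; the clause for \<open>n = 0\<close> fixes the initial
    map.\<close>
  have "\<exists>s. \<forall>n. (Q (s n) \<and> (n = 0 \<longrightarrow> s n = (A, f))) \<and>
      (R (s n) (s (Suc n)) \<and> e n \<in> fst (s (Suc n)) \<and> e n \<in> snd (s (Suc n)) ` fst (s (Suc n)))"
  proof (rule dependent_nat_choice)
    show "\<exists>x. Q x \<and> (0 = (0::nat) \<longrightarrow> x = (A, f))" using A by (simp add: Q_def)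
    fix x and n :: nat assume "Q x \<and> (n = 0 \<longrightarrow> x = (A, f))"
    moreover have "e n \<in> V" using e by blast
    ultimately show "\<exists>y. (Q y \<and> (Suc n = 0 \<longrightarrow> y = (A, f))) \<and>
        (R x y \<and> e n \<in> fst y \<and> e n \<in> snd y ` fst y)"
      using step[of x "e n"] by auto
  qed
  then obtain s where s: "\<And>n. Q (s n)" "s 0 = (A, f)" "\<And>n. R (s n) (s (Suc n))"
    "\<And>n. e n \<in> fst (s (Suc n))" "\<And>n. e n \<in> snd (s (Suc n)) ` fst (s (Suc n))"
    by blast
  have mono: "R (s i) (s j)" if "i \<le> j" for i j
    using that by (induction j rule: dec_induct) (use Rrefl Rtrans s(3) in blast)+
  \<comment> \<open>The union of the chain: values never change along \<open>R\<close>, so every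
    stage containing \<open>x\<close> yields the same one.\<close>
  define g where "g x = snd (s (SOME n. x \<in> fst (s n))) x" for x
  have g: "g x = snd (s n) x" if x: "x \<in> fst (s n)" for x n
  proof -
    define m where "m = (SOME n. x \<in> fst (s n))"
    have m: "x \<in> fst (s m)" unfolding m_def using x by (rule someI)
    have "snd (s m) x = snd (s n) x"
      using mono[of m n] mono[of n m] m x unfolding R_def by (metis nat_le_linear)
    then show ?thesis by (simp add: g_def m_def)
  qed
  show thesis
  proof (rule that)
    show "g x = f x" if "x \<in> A" for x using g[of x 0] s(2) that by simp
    show "V \<subseteq> g ` V"
    proof
      fix v assume "v \<in> V"
      then obtain n where n: "v = e n" using e by auto
      then obtain x where x: "x \<in> fst (s (Suc n))" "v = snd (s (Suc n)) x" using s(5) by auto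
      then have "x \<in> V" using s(1)[of "Suc n"] by (auto simp: Q_def)
      then show "v \<in> g ` V" using g[OF x(1)] x(2) by (metis imageI)
    qed
    fix S assume "finite S" "S \<subseteq> V"
    then have "\<exists>n. S \<subseteq> fst (s n)"
    proof (induction rule: finite_induct)
      case (insert x S)
      then obtain n m where n: "S \<subseteq> fst (s n)" and m: "x = e m" using e by auto
      have "fst (s n) \<subseteq> fst (s (max n (Suc m)))" "fst (s (Suc m)) \<subseteq> fst (s (max n (Suc m)))"
        using mono[of n "max n (Suc m)"] mono[of "Suc m" "max n (Suc m)"] by (auto simp: R_def)
      then have "insert x S \<subseteq> fst (s (max n (Suc m)))" using n m s(4)[of m] by auto
      then show ?case by blast
    qed auto
    then obtain n where "S \<subseteq> fst (s n)" by blast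
    then show "\<exists>B h. S \<subseteq> B \<and> P B h \<and> (\<forall>x\<in>B. g x = h x)"
      using s(1)[of n] g by (intro exI[of _ "fst (s n)"] exI[of _ "snd (s n)"]) (auto simp: Q_def)
  qed
qed

section \<open>One-point extensions of finite homomorphisms\<close>

definition forward_extensible :: "'a graph \<Rightarrow> bool" where
  "forward_extensible G \<longleftrightarrow> (\<forall>A f v. finite A \<and> A \<subseteq> verts G \<and> local_morph XH G A f \<and> v \<in> verts G - A \<longrightarrow>
     (\<exists>w\<in>verts G. \<forall>a\<in>A. adj G v a \<longrightarrow> adj G w (f a)))"

definition injectively_forward_extensible :: "'a graph \<Rightarrow> bool" where
  "injectively_forward_extensible G \<longleftrightarrow>
     (\<forall>A f v. finite A \<and> A \<subseteq> verts G \<and> local_morph XH G A f \<and> v \<in> verts G - A \<longrightarrow>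
     (\<exists>w\<in>verts G - f ` A. \<forall>a\<in>A. adj G v a \<longrightarrow> adj G w (f a)))"

text \<open>The new value \<open>w\<close> is outside the old image, so adding it keeps an injective
  \<open>f\<close> injective; one condition thus serves both homomorphisms and
  monomorphisms.\<close>

definition backward_extensible :: "'a graph \<Rightarrow> bool" where
  "backward_extensible G \<longleftrightarrow>
     (\<forall>A f w. finite A \<and> A \<subseteq> verts G \<and> local_morph XH G A f \<and> w \<in> verts G - f ` A \<longrightarrow>
     (\<exists>v\<in>verts G - A. \<forall>a\<in>A. adj G v a \<longrightarrow> adj G w (f a)))"

lemma forward_extensible_if_injectively:
  "injectively_forward_extensible G \<Longrightarrow> forward_extensible G"
  unfolding injectively_forward_extensible_def forward_extensible_def by (meson DiffD1)

lemma local_morph_insert: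
  assumes g: "is_graph G" and f: "local_morph X G A f" and v: "v \<notin> A" and w: "w \<in> verts G"
    and adj: "\<And>a. a \<in> A \<Longrightarrow> adj G v a \<Longrightarrow> adj G w (f a)"
    and X: "X = XH \<or> X = XM \<and> w \<notin> f ` A"
  shows "local_morph X G (insert v A) (f(v := w))"
proof -
  have e: "(f(v := w)) a = f a" if "a \<in> A" for a using that v by auto
  have "adj G ((f(v := w)) x) ((f(v := w)) y)"
    if "x \<in> insert v A" "y \<in> insert v A" "adj G x y" for x y
  proof -
    consider "x = v" "y \<in> A" | "y = v" "x \<in> A" | "x \<in> A" "y \<in> A"
      using \<open>x \<in> insert v A\<close> \<open>y \<in> insert v A\<close> \<open>adj G x y\<close> adj_irrefl[OF g] by blast
    then show ?thesis
    proof cases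
      case 1 then show ?thesis using adj that(3) e by simp
    next
      case 2 then show ?thesis using adj adj_sym[OF g] that(3) e by (metis fun_upd_same)
    next
      case 3 then show ?thesis using f that(3) e by (simp add: local_morph_def)
    qed
  qed
  moreover have "inj_on (f(v := w)) (insert v A)" if "X \<noteq> XH"
  proof -
    have "inj_on f A" "w \<notin> f ` A" using f X that by (auto simp: local_morph_def)
    then show ?thesis using v by (auto simp: inj_on_def)
  qed
  ultimately show ?thesis using f w X e by (auto simp: local_morph_def)
qed

text \<open>Preserving adjacency and being injective are conditions on pairs of vertices, so the
  limit map inherits them from its finite approximations.\<close>

lemma back_and_forth_endo:
  assumes g: "is_graph G" and cnt: "countable (verts G)" and ne: "verts G \<noteq> {}"
    and X: "X = XH \<or> X = XM"
    and A: "finite A" "A \<subseteq> verts G" "local_morph X G A f"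
    and fwd: "X = XH \<Longrightarrow> forward_extensible G" "X = XM \<Longrightarrow> injectively_forward_extensible G"
    and bwd: "backward_extensible G"
  obtains h where "endo G h" "h ` verts G = verts G" "X = XM \<Longrightarrow> inj_on h (verts G)"
    "\<And>x. x \<in> A \<Longrightarrow> h x = f x"
proof -
  have weak: "local_morph XH G B k" if "local_morph X G B k" for B k
    using that by (auto simp: local_morph_def)
  obtain h where h: "\<And>x. x \<in> A \<Longrightarrow> h x = f x" "verts G \<subseteq> h ` verts G"
    "\<And>S. finite S \<Longrightarrow> S \<subseteq> verts G \<Longrightarrow> \<exists>B k. S \<subseteq> B \<and> local_morph X G B k \<and> (\<forall>x\<in>B. h x = k x)"
  proof (rule back_and_forth[where P = "local_morph X G", OF cnt ne A])
    fix B k v assume B: "finite B" "B \<subseteq> verts G" "local_morph X G B k" "v \<in> verts G - B"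
    then obtain w where "w \<in> verts G" "X = XM \<longrightarrow> w \<notin> k ` B" "\<And>a. a \<in> B \<Longrightarrow> adj G v a \<Longrightarrow> adj G w (k a)"
      using X fwd weak[OF B(3)]
      unfolding forward_extensible_def injectively_forward_extensible_def by (metis DiffE xkind.distinct(1))
    then show "\<exists>w. local_morph X G (insert v B) (k(v := w))"
      using local_morph_insert[OF g B(3)] B X by blast
  next
    fix B k w assume B: "finite B" "B \<subseteq> verts G" "local_morph X G B k" "w \<in> verts G - k ` B"
    then obtain v where "v \<in> verts G - B" "\<And>a. a \<in> B \<Longrightarrow> adj G v a \<Longrightarrow> adj G w (k a)"
      using bwd weak[OF B(3)] unfolding backward_extensible_def by meson
    then show "\<exists>v\<in>verts G - B. local_morph X G (insert v B) (k(v := w))"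
      using local_morph_insert[OF g B(3)] B X by blast
  qed (rule that)
  have pair: "h x \<in> verts G \<and> (adj G x y \<longrightarrow> adj G (h x) (h y)) \<and> (X = XM \<longrightarrow> h x = h y \<longrightarrow> x = y)"
    if "x \<in> verts G" "y \<in> verts G" for x y
  proof -
    have "finite {x, y}" "{x, y} \<subseteq> verts G" using that by auto
    from h(3)[OF this] obtain B k
      where "{x, y} \<subseteq> B" "local_morph X G B k" "\<forall>x\<in>B. h x = k x"
      by (elim exE conjE) (rule that)
    then show ?thesis by (auto simp: local_morph_def inj_on_def)
  qed
  show thesis
  proof (rule that)
    show "endo G h" using pair by (auto simp: endo_def)
    show "h ` verts G = verts G" using pair h(2) by auto
    show "inj_on h (verts G)" if "X = XM" using pair that by (auto simp: inj_on_def)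
  qed (rule h(1))
qed

lemma HE_if_extensible:
  assumes "is_graph G" "countable (verts G)" "verts G \<noteq> {}"
    "forward_extensible G" "backward_extensible G"
  shows "homogeneous XH YE G"
  unfolding homogeneous_def
proof (intro allI impI, elim conjE)
  fix A f assume A: "A \<subseteq> verts G" "finite A" "local_morph XH G A f"
  show "\<exists>g. self_morph YE G g \<and> (\<forall>x\<in>A. g x = f x)"
    by (rule back_and_forth_endo[OF assms(1-3) _ A(2,1,3)])
      (use assms in \<open>auto simp: self_morph_def\<close>)
qed

lemma MB_if_extensible:
  assumes "is_graph G" "countable (verts G)" "verts G \<noteq> {}"
    "injectively_forward_extensible G" "backward_extensible G"
  shows "homogeneous XM YB G"
  unfolding homogeneous_def
proof (intro allI impI, elim conjE)
  fix A f assume A: "A \<subseteq> verts G" "finite A" "local_morph XM G A f"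
  show "\<exists>g. self_morph YB G g \<and> (\<forall>x\<in>A. g x = f x)"
  proof (rule back_and_forth_endo[OF assms(1-3) _ A(2,1,3)])
    fix h assume "endo G h" "h ` verts G = verts G" "XM = XM \<Longrightarrow> inj_on h (verts G)"
      "\<And>x. x \<in> A \<Longrightarrow> h x = f x"
    then show ?thesis by (intro exI[of _ h]) (simp add: self_morph_def bij_betw_def)
  qed (use assms in simp_all)
qed

section \<open>Extensibility of the graphs in the classification\<close>

lemma complete_extensible:
  assumes g: "is_graph G" and inf: "infinite (verts G)"
    and cpl: "\<And>x y. x \<in> verts G \<Longrightarrow> y \<in> verts G \<Longrightarrow> x \<noteq> y \<Longrightarrow> adj G x y"
  shows "injectively_forward_extensible G" "backward_extensible G"
proof -
  have ex: "\<exists>w. w \<in> verts G - B" if "finite B" for B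
    using Diff_infinite_finite[OF that inf] by (metis ex_in_conv finite.emptyI)
  show "injectively_forward_extensible G"
    unfolding injectively_forward_extensible_def
  proof (intro allI impI, elim conjE)
    fix A f v assume A: "finite A" "local_morph XH G A f"
    obtain w where "w \<in> verts G - f ` A" using ex[of "f ` A"] A by auto
    then show "\<exists>w\<in>verts G - f ` A. \<forall>a\<in>A. adj G v a \<longrightarrow> adj G w (f a)"
      using A(2) by (intro bexI[of _ w]) (auto simp: local_morph_def intro!: cpl)
  qed
  show "backward_extensible G"
    unfolding backward_extensible_def
  proof (intro allI impI, elim conjE)
    fix A f w assume A: "finite A" "local_morph XH G A f" "w \<in> verts G - f ` A"
    obtain v where "v \<in> verts G - A" using ex[of A] A by auto
    then show "\<exists>v\<in>verts G - A. \<forall>a\<in>A. adj G v a \<longrightarrow> adj G w (f a)"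
      using A(2,3) by (intro bexI[of _ v]) (auto simp: local_morph_def intro!: cpl)
  qed
qed

text \<open>Forwards, a cone over the image serves for every \<open>v\<close>. Backwards, a vertex
  with no neighbour in \<open>A\<close> makes the adjacency condition vacuous.\<close>

lemma all_cones_extensible:
  assumes g: "is_graph G" and "all_cones G" and "all_cones (complement G)"
  shows "injectively_forward_extensible G" "backward_extensible G"
proof -
  show "injectively_forward_extensible G"
    unfolding injectively_forward_extensible_def
  proof (intro allI impI, elim conjE)
    fix A f v assume A: "finite A" "local_morph XH G A f"
    then have "finite (f ` A)" "f ` A \<subseteq> verts G" by (auto simp: local_morph_def)
    then obtain w where w: "w \<in> verts G" "\<And>b. b \<in> f ` A \<Longrightarrow> adj G w b"
      using assms(2) unfolding all_cones_def has_cone_def by meson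
    then have "w \<notin> f ` A" using adj_irrefl[OF g] by blast
    then show "\<exists>w\<in>verts G - f ` A. \<forall>a\<in>A. adj G v a \<longrightarrow> adj G w (f a)"
      using w by blast
  qed
  show "backward_extensible G"
    unfolding backward_extensible_def
  proof (intro allI impI, elim conjE)
    fix A f w assume A: "finite A" "A \<subseteq> verts G"
    then have "has_cone (complement G) A" using assms(3) by (simp add: all_cones_def)
    then obtain v where "v \<in> verts G" "v \<notin> A" "\<And>a. a \<in> A \<Longrightarrow> \<not> adj G v a"
      by (rule has_cone_complement) blast
    then show "\<exists>v\<in>verts G - A. \<forall>a\<in>A. adj G v a \<longrightarrow> adj G w (f a)" by blast
  qed
qed

lemma fresh_class:
  assumes "infinite (class_of G ` V)" "finite B"
  obtains v where "v \<in> V" "class_of G v \<notin> class_of G ` B"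
proof -
  have "\<not> class_of G ` V \<subseteq> class_of G ` B"
    using assms finite_subset by blast
  then show thesis using that by blast
qed

text \<open>Forwards, a vertex in a part that misses the image is adjacent to all of it. Backwards,
  the part of the new argument is dictated by that of \<open>w\<close>.\<close>

lemma multipartite_extensible:
  assumes g: "is_graph G" and cl: "clustered (complement G)"
    and many: "infinite (class_of (complement G) ` verts G)"
    and inf: "\<And>x. x \<in> verts G \<Longrightarrow> infinite (class_of (complement G) x)"
  shows "injectively_forward_extensible G" "backward_extensible G"
proof -
  let ?c = "class_of (complement G)"
  have ceq: "?c x = ?c y \<longleftrightarrow> \<not> adj G x y" if "x \<in> verts G" "y \<in> verts G" for x y
    using class_of_eq_iff[OF is_graph_complement[OF g] cl, of x y] that adj_irrefl[OF g] by auto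
  show "injectively_forward_extensible G"
    unfolding injectively_forward_extensible_def
  proof (intro allI impI, elim conjE)
    fix A f v assume A: "finite A" "local_morph XH G A f"
    obtain w where w: "w \<in> verts G" "?c w \<notin> ?c ` f ` A"
      using fresh_class[OF many, of "f ` A"] A by auto
    then have "adj G w (f a)" if "a \<in> A" for a
      using ceq[of w "f a"] A(2) that by (auto simp: local_morph_def)
    moreover have "w \<notin> f ` A" using w by blast
    ultimately show "\<exists>w\<in>verts G - f ` A. \<forall>a\<in>A. adj G v a \<longrightarrow> adj G w (f a)"
      using w by blast
  qed
  show "backward_extensible G"
    unfolding backward_extensible_def
  proof (intro allI impI, elim conjE)
    fix A f w assume A: "finite A" "A \<subseteq> verts G" "local_morph XH G A f" "w \<in> verts G - f ` A"
    have fV: "f a \<in> verts G" if "a \<in> A" for a using A(3) that by (simp add: local_morph_def)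
    show "\<exists>v\<in>verts G - A. \<forall>a\<in>A. adj G v a \<longrightarrow> adj G w (f a)"
    \<comment> \<open>If \<open>w\<close> shares a part with some \<open>f b\<close>, a fresh
      \<open>v\<close> in the part of \<open>b\<close> works: a neighbour \<open>a\<close> of
      \<open>v\<close> is adjacent to \<open>b\<close>, so \<open>f a\<close> lies outside the part
      of \<open>f b\<close> and \<open>w\<close>. Otherwise \<open>w\<close> is adjacent to the
      whole image and any fresh \<open>v\<close> will do.\<close>
    proof (cases "\<exists>b\<in>A. \<not> adj G w (f b)")
      case True
      then obtain b where b: "b \<in> A" "\<not> adj G w (f b)" by blast
      have "infinite (?c b - A)" using inf[of b] b(1) A by auto
      then obtain v where v: "v \<in> ?c b" "v \<notin> A" by (metis Diff_iff ex_in_conv finite.emptyI)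
      have vV: "v \<in> verts G" using v(1) by (simp add: class_of_def)
      have "?c v = ?c b"
        using v b A ceq[of b v] vV by (auto simp: class_of_def)
      moreover have "adj G w (f a)" if "a \<in> A" "adj G v a" for a
      proof (rule ccontr)
        assume "\<not> adj G w (f a)"
        then have "?c w = ?c (f a)" "?c w = ?c (f b)" using ceq A(4) fV b that by auto
        then have "\<not> adj G (f b) (f a)" using ceq[of "f b" "f a"] fV b that by auto
        then have "\<not> adj G b a" using A(3) b that by (auto simp: local_morph_def)
        then have "?c b = ?c a" using ceq b that A by auto
        then have "?c v = ?c a" using \<open>?c v = ?c b\<close> by simp
        then show False using ceq[of v a] vV A that by auto
      qed
      ultimately show ?thesis using v vV by blast
    next
      case False
      have "?c w \<subseteq> verts G" by (auto simp: class_of_def)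
      moreover have "infinite (?c w)" using inf A by auto
      ultimately have "infinite (verts G)" using finite_subset by blast
      then have "infinite (verts G - A)" using A(1) by simp
      then obtain v where "v \<in> verts G - A" by (metis ex_in_conv finite.emptyI)
      then show ?thesis using False by blast
    qed
  qed
qed

text \<open>A neighbour \<open>b\<close> of \<open>v\<close> in \<open>A\<close> forces the new
  value into the cluster of \<open>f b\<close>. In a finite cluster, vertices from other clusters
  may already have used up the free places, which is why injectivity is claimed only for infinite or
  singleton clusters. Backwards, a vertex in a cluster that misses \<open>A\<close> has no
  constraints.\<close>

lemma uniform_clusters_extensible:
  assumes g: "is_graph G" and uc: "uniform_clusters G"
  shows "forward_extensible G" "backward_extensible G"
    and "(\<forall>x\<in>verts G. infinite (class_of G x)) \<or> (\<forall>x\<in>verts G. class_of G x = {x}) \<Longrightarrow>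
      injectively_forward_extensible G"
proof -
  have cl: "clustered G" and many: "infinite (class_of G ` verts G)"
    using uc unfolding uniform_clusters_def by blast+
  note ceq = class_of_eq_iff[OF g cl]
  have sz: "infinite (class_of G x) \<and> infinite (class_of G y) \<or>
      finite (class_of G x) \<and> finite (class_of G y) \<and> card (class_of G x) = card (class_of G y)"
    if "x \<in> verts G" "y \<in> verts G" for x y
  proof -
    have "(\<forall>x\<in>verts G. infinite (class_of G x)) \<or>
        (\<exists>n. \<forall>x\<in>verts G. finite (class_of G x) \<and> card (class_of G x) = n)"
      using uc unfolding uniform_clusters_def by blast
    then show ?thesis using that by metis
  qed
  have into: "f a \<in> class_of G (f b)"
    if "local_morph XH G A f" "a \<in> A" "b \<in> A" "adj G b a \<or> a = b" for A f a b
    using that by (auto simp: local_morph_def class_of_def)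
  \<comment> \<open>A homomorphism is injective on each cluster, so the target cluster still has room.\<close>
  have room: "\<exists>w\<in>verts G. (\<forall>a\<in>A. adj G v a \<longrightarrow> adj G w (f a)) \<and>
      (infinite (class_of G v) \<longrightarrow> w \<notin> f ` A)"
    if A: "finite A" "A \<subseteq> verts G" "local_morph XH G A f" "v \<in> verts G - A"
      and b: "b \<in> A" "adj G v b" for A f v b
  proof -
    define S where "S = {a \<in> A. adj G v a}"
    have fV: "f b \<in> verts G" and vV: "v \<in> verts G" using A b by (auto simp: local_morph_def)
    have "S \<subseteq> class_of G v - {v}" using A by (auto simp: S_def class_of_def)
    have S: "adj G x y" if "x \<in> S" "y \<in> S" "x \<noteq> y" for x y
      using cl that adj_sym[OF g] unfolding S_def clustered_def by blast
    have T: "f a \<in> class_of G (f b)" if "a \<in> S" for a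
      using into[OF A(3), of a b] S[of b a] that b by (auto simp: S_def)
    have ex: "\<exists>w\<in>class_of G (f b). w \<notin> f ` S \<and> (infinite (class_of G v) \<longrightarrow> w \<notin> f ` A)"
    proof (cases "finite (class_of G v)")
      case False
      then have "infinite (class_of G (f b) - f ` A)" using sz[OF vV fV] A(1) by auto
      then obtain w where "w \<in> class_of G (f b) - f ` A" by (metis ex_in_conv finite.emptyI)
      then show ?thesis by (auto simp: S_def)
    next
      case True
      \<comment> \<open>\<open>S\<close> omits \<open>v\<close>, so its image has fewer elements
        than the equally large cluster of \<open>f b\<close>.\<close>
      have "card (f ` S) \<le> card S" using A(1) by (intro card_image_le) (simp add: S_def)
      also have "\<dots> \<le> card (class_of G v - {v})"
        using True \<open>S \<subseteq> class_of G v - {v}\<close> by (intro card_mono) auto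
      also have "\<dots> < card (class_of G v)"
        using True vV by (intro card_Diff1_less) (auto simp: class_of_def)
      also have "\<dots> = card (class_of G (f b))" using sz[OF vV fV] True by auto
      finally have "\<not> class_of G (f b) \<subseteq> f ` S"
        using A(1) by (metis S_def card_mono finite_imageI finite_subset mem_Collect_eq not_le subsetI)
      then show ?thesis using True by blast
    qed
    then obtain w where w: "w \<in> class_of G (f b)" "w \<notin> f ` S" "infinite (class_of G v) \<longrightarrow> w \<notin> f ` A"
      by blast
    have "adj G w (f a)" if "a \<in> A" "adj G v a" for a
    proof -
      have "a \<in> S" using that by (simp add: S_def)
      then have "f a \<in> class_of G (f b)" "w \<noteq> f a" using T w(2) by auto
      moreover from this have "f a = f b \<or> adj G (f b) (f a)" "w = f b \<or> adj G w (f b)"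
        using w(1) adj_sym[OF g] by (auto simp: class_of_def)
      ultimately show ?thesis
        using cl unfolding clustered_def by metis
    qed
    then show ?thesis using w by (auto simp: class_of_def)
  qed
  show "forward_extensible G"
    unfolding forward_extensible_def
  proof (intro allI impI, elim conjE)
    fix A f v assume A: "finite A" "A \<subseteq> verts G" "local_morph XH G A f" "v \<in> verts G - A"
    show "\<exists>w\<in>verts G. \<forall>a\<in>A. adj G v a \<longrightarrow> adj G w (f a)"
      using room[OF A] A(4) by (cases "\<exists>b\<in>A. adj G v b") blast+
  qed
  show "injectively_forward_extensible G"
    if t: "(\<forall>x\<in>verts G. infinite (class_of G x)) \<or> (\<forall>x\<in>verts G. class_of G x = {x})"
    unfolding injectively_forward_extensible_def
  proof (intro allI impI, elim conjE)
    fix A f v assume A: "finite A" "A \<subseteq> verts G" "local_morph XH G A f" "v \<in> verts G - A"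
    show "\<exists>w\<in>verts G - f ` A. \<forall>a\<in>A. adj G v a \<longrightarrow> adj G w (f a)"
    proof (cases "\<exists>b\<in>A. adj G v b")
      case True
      then obtain b where b: "b \<in> A" "adj G v b" by blast
      then have "b \<in> class_of G v" "b \<noteq> v" using A by (auto simp: class_of_def)
      then have "infinite (class_of G v)" using t A(4) by auto
      then show ?thesis using room[OF A b] by blast
    next
      case False
      obtain w where "w \<in> verts G" "class_of G w \<notin> class_of G ` f ` A"
        using fresh_class[OF many, of "f ` A"] A by auto
      then show ?thesis using False by blast
    qed
  qed
  show "backward_extensible G"
    unfolding backward_extensible_def
  proof (intro allI impI, elim conjE)
    fix A f w assume A: "finite A" "A \<subseteq> verts G"
    obtain v where v: "v \<in> verts G" "class_of G v \<notin> class_of G ` A"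
      using fresh_class[OF many A(1)] by auto
    then have "\<not> adj G v a" if "a \<in> A" for a using that A ceq[of v a] by auto
    moreover have "v \<notin> A" using v by blast
    ultimately show "\<exists>v\<in>verts G - A. \<forall>a\<in>A. adj G v a \<longrightarrow> adj G w (f a)" using v by blast
  qed
qed

section \<open>Identification with the product of \<open>I_omega\<close> and
  \<open>K n\<close>\<close>

lemma uniform_clusters_iso:
  assumes g: "is_graph G" and cnt: "countable (verts G)" and cl: "clustered G"
    and many: "infinite (class_of G ` verts G)"
    and sz: "\<And>x. x \<in> verts G \<Longrightarrow> finite (class_of G x) \<and> card (class_of G x) = n"
  shows "graph_iso G (lex_prod I_omega (K n))"
proof -
  note ceq = class_of_eq_iff[OF g cl]
  define q where "q = to_nat_on (class_of G ` verts G)"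
  have q: "bij_betw q (class_of G ` verts G) UNIV"
    unfolding q_def using many cnt by (intro to_nat_on_infinite) auto
  have "\<exists>b. bij_betw b (class_of G x) {..<n}" if "x \<in> verts G" for x
    using finite_same_card_bij[of "class_of G x" "{..<n}"] sz[OF that] by auto
  then have "\<forall>c\<in>class_of G ` verts G. \<exists>b. bij_betw b c {..<n}" by blast
  then obtain b where b: "\<And>c. c \<in> class_of G ` verts G \<Longrightarrow> bij_betw (b c) c {..<n}"
    by metis
  \<comment> \<open>The coordinates are the number of the cluster and the position of
    \<open>x\<close> inside it.\<close>
  define h where "h x = (q (class_of G x), b (class_of G x) x)" for x
  have self: "x \<in> class_of G x" if "x \<in> verts G" for x using that by (simp add: class_of_def)
  have qe: "q (class_of G x) = q (class_of G y) \<longleftrightarrow> x = y \<or> adj G x y"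
    if "x \<in> verts G" "y \<in> verts G" for x y
    using inj_on_eq_iff[OF bij_betw_imp_inj_on[OF q], of "class_of G x" "class_of G y"]
      ceq[OF that] that by simp
  have be: "b (class_of G x) x \<noteq> b (class_of G y) y"
    if xy: "x \<in> verts G" "y \<in> verts G" "adj G x y" for x y
  proof -
    have "class_of G x = class_of G y" using ceq xy by blast
    moreover have "inj_on (b (class_of G x)) (class_of G x)"
      using b xy by (auto simp: bij_betw_def)
    moreover have "x \<noteq> y" using xy adj_irrefl[OF g] by blast
    ultimately show ?thesis using self xy by (metis inj_onD)
  qed
  have bn: "b (class_of G x) x < n" if "x \<in> verts G" for x
    using bij_betw_apply[OF b self] that by auto
  have "inj_on h (verts G)"
  proof (rule inj_onI)
    fix x y assume xy: "x \<in> verts G" "y \<in> verts G" "h x = h y"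
    then show "x = y" using qe[OF xy(1,2)] be[OF xy(1,2)] by (auto simp: h_def)
  qed
  moreover have "h ` verts G = UNIV \<times> {..<n}"
  proof
    show "h ` verts G \<subseteq> UNIV \<times> {..<n}" using bn by (auto simp: h_def)
    show "UNIV \<times> {..<n} \<subseteq> h ` verts G"
    proof
      fix p assume "p \<in> (UNIV :: nat set) \<times> {..<n}"
      then obtain i j where p: "p = (i, j)" "j < n" by auto
      obtain x where x: "x \<in> verts G" "q (class_of G x) = i"
        using q unfolding bij_betw_def by (metis (no_types, lifting) UNIV_I imageE)
      then obtain y where y: "y \<in> class_of G x" "b (class_of G x) y = j"
        using b[of "class_of G x"] p(2) unfolding bij_betw_def
        by (metis (no_types, lifting) imageE imageI lessThan_iff)
      have "y \<in> verts G" "class_of G x = class_of G y"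
        using y(1) x ceq[of x y] by (auto simp: class_of_def)
      then show "p \<in> h ` verts G" using x y p by (auto simp: h_def image_iff intro!: bexI[of _ y])
    qed
  qed
  ultimately have "bij_betw h (verts G) (verts (lex_prod I_omega (K n)))"
    by (simp add: bij_betw_def lex_prod_def verts_def I_omega_def edgeless_def K_def complete_def)
  moreover have "adj G x y \<longleftrightarrow> adj (lex_prod I_omega (K n)) (h x) (h y)"
    if "x \<in> verts G" "y \<in> verts G" for x y
    using qe[OF that] be[OF that] bn[OF that(1)] bn[OF that(2)] adj_irrefl[OF g]
    by (auto simp: lex_prod_def verts_def adj_def I_omega_def edgeless_def K_def complete_def h_def)
  ultimately show ?thesis unfolding graph_iso_def by blast
qed

text \<open>Clusters are the fibres of the first coordinate. The bound on \<open>n\<close> makes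
  every fibre nonempty, so that there are infinitely many clusters.\<close>

lemma iso_uniform_clusters:
  assumes g: "is_graph G" and n: "n \<ge> 1" and iso: "graph_iso G (lex_prod I_omega (K n))"
  shows "uniform_clusters G"
proof -
  obtain h where h: "bij_betw h (verts G) (UNIV \<times> {..<n})"
    and adj: "\<And>x y. x \<in> verts G \<Longrightarrow> y \<in> verts G \<Longrightarrow> adj G x y \<longleftrightarrow> adj (lex_prod I_omega (K n)) (h x) (h y)"
    using iso unfolding graph_iso_def
    by (auto simp: lex_prod_def verts_def I_omega_def edgeless_def K_def complete_def)
  have hx: "snd (h x) < n" if "x \<in> verts G" for x
    using bij_betw_apply[OF h that] by auto
  have e: "adj G x y \<longleftrightarrow> fst (h x) = fst (h y) \<and> x \<noteq> y" if "x \<in> verts G" "y \<in> verts G" for x y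
  proof -
    have "h x = h y \<longleftrightarrow> x = y" using h that by (auto simp: bij_betw_def inj_on_def)
    then show ?thesis using adj[OF that] hx[OF that(1)] hx[OF that(2)]
      by (auto simp: lex_prod_def verts_def adj_def I_omega_def edgeless_def K_def complete_def
          prod_eq_iff split: prod.splits)
  qed
  have cl: "clustered G"
    using e adj_verts[OF g] unfolding clustered_def by metis
  have c: "class_of G x = {y \<in> verts G. fst (h y) = fst (h x)}" if "x \<in> verts G" for x
    using e that by (auto simp: class_of_def)
  have sz: "finite (class_of G x) \<and> card (class_of G x) = n" if "x \<in> verts G" for x
  proof -
    have "h ` class_of G x = {fst (h x)} \<times> {..<n}"
    proof
      show "h ` class_of G x \<subseteq> {fst (h x)} \<times> {..<n}"
        by (rule image_subsetI) (use hx in \<open>auto simp: c[OF that] mem_Times_iff\<close>)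
      show "{fst (h x)} \<times> {..<n} \<subseteq> h ` class_of G x"
      proof
        fix p assume p: "p \<in> {fst (h x)} \<times> {..<n}"
        then have "p \<in> h ` verts G" using h by (auto simp: bij_betw_def)
        then obtain y where "y \<in> verts G" "p = h y" by blast
        then show "p \<in> h ` class_of G x" using p by (auto simp: c[OF that])
      qed
    qed
    moreover have "inj_on h (class_of G x)"
      using h by (auto simp: bij_betw_def class_of_def intro: inj_on_subset)
    ultimately have "bij_betw h (class_of G x) ({fst (h x)} \<times> {..<n})"
      by (simp add: bij_betw_def)
    then show ?thesis
      using bij_betw_finite[of h] bij_betw_same_card[of h] by fastforce
  qed
  have "infinite (class_of G ` verts G)"
  proof
    assume fin: "finite (class_of G ` verts G)"
    \<comment> \<open>The first coordinate is constant on a cluster; \<open>t\<close> reads it off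
      and maps the clusters onto the natural numbers.\<close>
    define t where "t c = (THE i. \<exists>y\<in>c. i = fst (h y))" for c
    have "t ` class_of G ` verts G = (\<lambda>x. fst (h x)) ` verts G"
      unfolding image_image t_def by (intro image_cong refl the_equality) (auto simp: c)
    also have "\<dots> = fst ` (UNIV \<times> {..<n})"
      using h unfolding bij_betw_def by (metis image_image)
    also have "\<dots> = (UNIV :: nat set)" using n by (auto simp: fst_image_times lessThan_empty_iff)
    finally show False using finite_imageI[OF fin, of t] infinite_UNIV_nat by simp
  qed
  then show ?thesis using cl sz unfolding uniform_clusters_def by blast
qed

section \<open>The classification\<close>

text \<open>The complete graph is a single clique and is split off because
  \<open>ME_clustered\<close> starts from a non-edge. In every case except finite cliques of size at
  least 2 the forward extensions can be chosen injective, which gives MB.\<close>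

lemma ME_imp_HE_and_MB_or_iso:
  assumes g: "is_graph G" and cnt: "countable (verts G)" and inf: "infinite (verts G)"
    and me: "homogeneous XM YE G"
  shows "homogeneous XH YE G \<and>
    (homogeneous XM YB G \<or> (\<exists>n\<ge>2. graph_iso G (lex_prod I_omega (K n))))"
proof -
  have ne: "verts G \<noteq> {}" using inf by auto
  note HE = HE_if_extensible[OF g cnt ne] and MB = MB_if_extensible[OF g cnt ne]
  have both: ?thesis if "injectively_forward_extensible G" "backward_extensible G"
    using HE MB forward_extensible_if_injectively that by blast
  consider (complete) "\<forall>x\<in>verts G. \<forall>y\<in>verts G. x \<noteq> y \<longrightarrow> adj G x y"
    | (clusters) "uniform_clusters G"
    | (multipartite) "clustered (complement G)" "\<not> clustered G"
    | (cones) "\<not> clustered (complement G)" "\<not> clustered G"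
    using ME_clustered[OF g inf me] by blast
  then show ?thesis
  proof cases
    case complete
    then show ?thesis using both complete_extensible[OF g inf] by blast
  next
    case multipartite
    then show ?thesis
      using both multipartite_extensible[OF g multipartite(1)]
        ME_complement_clustered[OF g me multipartite] by blast
  next
    case cones
    then show ?thesis
      using both all_cones_extensible[OF g] ME_cone_transfer[OF me]
        ME_cone_transfer_complement[OF g me] all_cones_in_graph_and_complement[OF g inf] by blast
  next
    case clusters
    note ext = uniform_clusters_extensible[OF g clusters]
    have cl: "clustered G" "infinite (class_of G ` verts G)"
      using clusters unfolding uniform_clusters_def by blast+
    show ?thesis
    proof (cases "\<forall>x\<in>verts G. infinite (class_of G x)")
      case True
      then show ?thesis using both ext by blast
    next
      case False
      then obtain n where n: "\<And>x. x \<in> verts G \<Longrightarrow> finite (class_of G x) \<and> card (class_of G x) = n"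
        using clusters unfolding uniform_clusters_def by metis
      have self: "x \<in> class_of G x" if "x \<in> verts G" for x using that by (simp add: class_of_def)
      show ?thesis
      proof (cases "n \<ge> 2")
        case True
        then show ?thesis
          using HE[OF ext(1,2)] uniform_clusters_iso[OF g cnt cl n] by blast
      next
        case False
        \<comment> \<open>Each class contains its own \<open>x\<close>, so \<open>n\<close> is not 0
          and must be 1: the graph is edgeless.\<close>
        have "class_of G x = {x}" if "x \<in> verts G" for x
        proof -
          have "card (class_of G x) \<noteq> 0" using n[OF that] self[OF that] by (metis card_0_eq empty_iff)
          then have "card (class_of G x) = 1" using n[OF that] False by linarith
          then show ?thesis using self[OF that] by (auto simp: card_1_singleton_iff)
        qed
        then show ?thesis using both ext by blast
      qed
    qed
  qed
qed

text \<open>ME follows from HE because monomorphisms are homomorphisms, and from MB because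
  bimorphisms are epimorphisms. The product graphs are HE by their cluster structure, and
  \<open>ME_imp_HE_and_MB_or_iso\<close> closes the circle.\<close>

theorem theorem8p3:
  fixes G :: "'a graph"
  assumes "is_graph G" and "countable (verts G)" and "infinite (verts G)"
  shows "(homogeneous XM YE G \<longleftrightarrow> homogeneous XH YE G) \<and>
         (homogeneous XH YE G \<longleftrightarrow>
            (homogeneous XM YB G \<or>
             (\<exists>n::nat. n \<ge> 2 \<and> graph_iso G (lex_prod I_omega (K n)))))"
proof -
  have HE_ME: "homogeneous XM YE G" if "homogeneous XH YE G"
    using that by (auto simp: homogeneous_def local_morph_def)
  have MB_ME: "homogeneous XM YE G" if "homogeneous XM YB G"
    using that unfolding homogeneous_def self_morph_def bij_betw_def by simp meson
  have iso_HE: "homogeneous XH YE G" if "n \<ge> 2" "graph_iso G (lex_prod I_omega (K n))" for n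
  proof -
    have "uniform_clusters G" by (rule iso_uniform_clusters[OF assms(1) _ that(2)]) (use that in simp)
    then show ?thesis
      using assms(3) uniform_clusters_extensible[OF assms(1)]
      by (intro HE_if_extensible[OF assms(1,2)]) auto
  qed
  show ?thesis
    using HE_ME MB_ME iso_HE ME_imp_HE_and_MB_or_iso[OF assms] by blast
qed

end
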